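(* Let $T$ be the equational theory whose axioms are those of $\mathrm{ACP}^{\tau}_{\mathrm{drt}}$ together with the axioms of standard concurrency $x\parallel y=y\parallel x$, $(x\parallel y)\parallel z=x\parallel(y\parallel z)$, $(x\lfloor\!\lfloor y)\lfloor\!\lfloor z=x\lfloor\!\lfloor(y\parallel z)$, $x\mid y=y\mid x$, $(x\mid y)\mid z=x\mid(y\mid z)$, $x\mid(y\lfloor\!\lfloor z)=(x\mid y)\lfloor\!\lfloor z$, and the handshaking axiom $\nu(x\mid y\mid z)=\underline\delta$. Then for every $n>2$ the following equation is derivable in $T$: $$x_1\parallel\cdots\parallel x_n=\sum_{1\le i\le n}x_i\lfloor\!\lfloor\Bigl(\mathop{\Big\|}_{1\le j\le n,\,j\neq i}x_j\Bigr)+\sum_{1\le i\le n,\ i<j\le n}(x_i\mid x_j)\lfloor\!\lfloor\Bigl(\mathop{\Big\|}_{1\le k\le n,\,k\neq i,\,k\neq j}x_k\Bigr).$$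
   Context: Fix a finite set $A$ of basic actions with $\tau,\delta\notin A$, and a commutative and associative function $\gamma:(A\cup\{\tau,\delta\})\times(A\cup\{\tau,\delta\})\to A\cup\{\tau,\delta\}$ with $\gamma(\tau,a)=\gamma(\delta,a)=\delta$ for all $a$. The signature of $\mathrm{ACP}^{\tau}_{\mathrm{drt}}$ consists of the constants $\underline{a}$ ($a\in A$), $\underline{\tau}$, $\underline{\delta}$; the binary operators $+$, $\cdot$, $\parallel$ (parallel composition), $\lfloor\!\lfloor$ (left merge), $\mid$ (communication merge); and the unary operators $\sigma$ (one-time-slice delay), $\partial_H$ for each $H\subseteq A$, $\tau_I$ for each $I\subseteq A$, and $\nu$ (current-time-slice time-out). In terms, $\cdot$ binds strongest and $+$ weakest. Finite sums $\sum$ and finite parallel compositions $\|$ are well defined modulo associativity and commutativity. The axioms of $\mathrm{ACP}^{\tau}_{\mathrm{drt}}$ are the following equations, where $a,b,c$ range over $A\cup\{\tau,\delta\}$ and $H,I\subseteq A$: $x+y=y+x$; $(x+y)+z=x+(y+z)$; $x+x=x$; $(x+y)\cdot z=x\cdot z+y\cdot z$; $(x\cdot y)\cdot z=x\cdot(y\cdot z)$; $x+\underline{\delta}=x$; $\underline{\delta}\cdot x=\underline{\delta}$; $\sigma(x)+\sigma(y)=\sigma(x+y)$; $\sigma(x)\cdot y=\sigma(x\cdot y)$; $\partial_H(\underline a)=\underline a$ if $a\notin H$; $\partial_H(\underline a)=\underline\delta$ if $a\in H$; $\partial_H(x+y)=\partial_H(x)+\partial_H(y)$; $\partial_H(x\cdot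 y)=\partial_H(x)\cdot\partial_H(y)$; $\partial_H(\sigma(x))=\sigma(\partial_H(x))$; $\tau_I(\underline a)=\underline a$ if $a\notin I$; $\tau_I(\underline a)=\underline\tau$ if $a\in I$; $\tau_I(x+y)=\tau_I(x)+\tau_I(y)$; $\tau_I(x\cdot y)=\tau_I(x)\cdot\tau_I(y)$; $\tau_I(\sigma(x))=\sigma(\tau_I(x))$; $x\parallel y=(x\lfloor\!\lfloor y+y\lfloor\!\lfloor x)+x\mid y$; $\underline a\lfloor\!\lfloor x=\underline a\cdot x$; $\underline a\cdot x\lfloor\!\lfloor y=\underline a\cdot(x\parallel y)$; $\sigma(x)\lfloor\!\lfloor\nu(y)=\underline\delta$; $\sigma(x)\lfloor\!\lfloor(\nu(y)+\sigma(z))=\sigma(x\lfloor\!\lfloor z)$; $(x+y)\lfloor\!\lfloor z=x\lfloor\!\lfloor z+y\lfloor\!\lfloor z$; $\underline a\cdot x\mid\underline b=(\underline a\mid\underline b)\cdot x$; $\underline a\mid\underline b\cdot x=(\underline a\mid\underline b)\cdot x$; $\underline a\cdot x\mid\underline b\cdot y=(\underline a\mid\underline b)\cdot(x\parallel y)$; $\nu(x)\mid\sigma(y)=\underline\delta$; $\sigma(x)\mid\nu(y)=\underline\delta$; $\sigma(x)\mid\sigma(y)=\sigma(x\mid y)$; $(x+y)\mid z=x\mid z+y\mid z$; $x\mid(y+z)=x\mid y+x\mid z$; $\underline a\mid\underline b=\underline c$ if $\gamma(a,b)=c$; $\nu(\underline a)=\underline a$; $\nu(x+y)=\nu(x)+\nu(y)$;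 $\nu(x\cdot y)=\nu(x)\cdot y$; $\nu(\sigma(x))=\underline\delta$; $\underline a\cdot\underline\tau=\underline a$; $\underline a\cdot(\underline\tau\cdot(\nu(x)+y)+\nu(x))=\underline a\cdot(\nu(x)+y)$; $\underline a\cdot(\underline\tau\cdot(\nu(x)+y)+y)=\underline a\cdot(\nu(x)+y)$; $\underline a\cdot(\sigma(\underline\tau\cdot x)+\nu(y))=\underline a\cdot(\sigma(x)+\nu(y))$.
   Formalization: The equation is proved for all closed terms x_1,…,x_n; with variables x_i it is not derivable in T: on {0,1} with + as OR, ∥ and | as AND and all else constantly 0, every axiom holds, but for all x_i = 1 the left side is 1 and the right side 0. *)

theory Defs
  imports Main
begin

datatype 'a act = Act 'a | Tau | Delta

definition acts :: "'a set \<Rightarrow> 'a act set" where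
  "acts A = Act ` A \<union> {Tau, Delta}"

datatype 'a trm =
    Var nat
  | Const "'a act"
  | Alt "'a trm" "'a trm" (infixr \<open>\<oplus>\<close> 65)
  | Seq "'a trm" "'a trm" (infixr \<open>\<odot>\<close> 80)
  | Par "'a trm" "'a trm" (infixr \<open>\<parallel>\<close> 70)
  | LMerge "'a trm" "'a trm" (infix \<open>\<parallel>\<^sub>L\<close> 70)
  | CMerge "'a trm" "'a trm" (infix \<open>\<parallel>\<^sub>C\<close> 70)
  | Delay "'a trm"
  | Encap "'a set" "'a trm"
  | Abstr "'a set" "'a trm"
  | Tout "'a trm"

primrec wf_trm :: "'a set \<Rightarrow> 'a trm \<Rightarrow> bool" where
  "wf_trm A (Var v) \<longleftrightarrow> True"
| "wf_trm A (Const a) \<longleftrightarrow> a \<in> acts A"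
| "wf_trm A (x \<oplus> y) \<longleftrightarrow> wf_trm A x \<and> wf_trm A y"
| "wf_trm A (x \<odot> y) \<longleftrightarrow> wf_trm A x \<and> wf_trm A y"
| "wf_trm A (x \<parallel> y) \<longleftrightarrow> wf_trm A x \<and> wf_trm A y"
| "wf_trm A (x \<parallel>\<^sub>L y) \<longleftrightarrow> wf_trm A x \<and> wf_trm A y"
| "wf_trm A (x \<parallel>\<^sub>C y) \<longleftrightarrow> wf_trm A x \<and> wf_trm A y"
| "wf_trm A (Delay x) \<longleftrightarrow> wf_trm A x"
| "wf_trm A (Encap H x) \<longleftrightarrow> H \<subseteq> A \<and> wf_trm A x"
| "wf_trm A (Abstr I x) \<longleftrightarrow> I \<subseteq> A \<and> wf_trm A x"
| "wf_trm A (Tout x) \<longleftrightarrow> wf_trm A x"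

primrec trm_vars :: "'a trm \<Rightarrow> nat set" where
  "trm_vars (Var v) = {v}"
| "trm_vars (Const a) = {}"
| "trm_vars (x \<oplus> y) = trm_vars x \<union> trm_vars y"
| "trm_vars (x \<odot> y) = trm_vars x \<union> trm_vars y"
| "trm_vars (x \<parallel> y) = trm_vars x \<union> trm_vars y"
| "trm_vars (x \<parallel>\<^sub>L y) = trm_vars x \<union> trm_vars y"
| "trm_vars (x \<parallel>\<^sub>C y) = trm_vars x \<union> trm_vars y"
| "trm_vars (Delay x) = trm_vars x"
| "trm_vars (Encap H x) = trm_vars x"
| "trm_vars (Abstr I x) = trm_vars x"
| "trm_vars (Tout x) = trm_vars x"

definition closed_trm :: "'a set \<Rightarrow> 'a trm \<Rightarrow> bool" where
  "closed_trm A t \<longleftrightarrow> wf_trm A t \<and> trm_vars t = {}"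

text \<open>
  The axiom predicates contain all substitution instances of the axioms. The restrictions
  \<open>a, b, c \<in> acts A\<close> and \<open>H, I \<subseteq> A\<close> are not repeated in each axiom: derivations only use
  instances both of whose sides are well-formed over \<open>A\<close>.
\<close>

inductive acp_axiom :: "('a act \<Rightarrow> 'a act \<Rightarrow> 'a act) \<Rightarrow> 'a trm \<Rightarrow> 'a trm \<Rightarrow> bool"
  for \<gamma> where
  A1: "acp_axiom \<gamma> (x \<oplus> y) (y \<oplus> x)"
| A2: "acp_axiom \<gamma> ((x \<oplus> y) \<oplus> z) (x \<oplus> (y \<oplus> z))"
| A3: "acp_axiom \<gamma> (x \<oplus> x) x"
| A4: "acp_axiom \<gamma> ((x \<oplus> y) \<odot> z) (x \<odot> z \<oplus> y \<odot> z)"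
| A5: "acp_axiom \<gamma> ((x \<odot> y) \<odot> z) (x \<odot> (y \<odot> z))"
| A6: "acp_axiom \<gamma> (x \<oplus> Const Delta) x"
| A7: "acp_axiom \<gamma> (Const Delta \<odot> x) (Const Delta)"
| S1: "acp_axiom \<gamma> (Delay x \<oplus> Delay y) (Delay (x \<oplus> y))"
| S2: "acp_axiom \<gamma> (Delay x \<odot> y) (Delay (x \<odot> y))"
| D1: "a \<notin> Act ` H \<Longrightarrow> acp_axiom \<gamma> (Encap H (Const a)) (Const a)"
| D2: "a \<in> Act ` H \<Longrightarrow> acp_axiom \<gamma> (Encap H (Const a)) (Const Delta)"
| D3: "acp_axiom \<gamma> (Encap H (x \<oplus> y)) (Encap H x \<oplus> Encap H y)"
| D4: "acp_axiom \<gamma> (Encap H (x \<odot> y)) (Encap H x \<odot> Encap H y)"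
| D5: "acp_axiom \<gamma> (Encap H (Delay x)) (Delay (Encap H x))"
| T1: "a \<notin> Act ` I \<Longrightarrow> acp_axiom \<gamma> (Abstr I (Const a)) (Const a)"
| T2: "a \<in> Act ` I \<Longrightarrow> acp_axiom \<gamma> (Abstr I (Const a)) (Const Tau)"
| T3: "acp_axiom \<gamma> (Abstr I (x \<oplus> y)) (Abstr I x \<oplus> Abstr I y)"
| T4: "acp_axiom \<gamma> (Abstr I (x \<odot> y)) (Abstr I x \<odot> Abstr I y)"
| T5: "acp_axiom \<gamma> (Abstr I (Delay x)) (Delay (Abstr I x))"
| M1: "acp_axiom \<gamma> (x \<parallel> y) ((x \<parallel>\<^sub>L y \<oplus> y \<parallel>\<^sub>L x) \<oplus> x \<parallel>\<^sub>C y)"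
| M2: "acp_axiom \<gamma> (Const a \<parallel>\<^sub>L x) (Const a \<odot> x)"
| M3: "acp_axiom \<gamma> ((Const a \<odot> x) \<parallel>\<^sub>L y) (Const a \<odot> (x \<parallel> y))"
| M4: "acp_axiom \<gamma> (Delay x \<parallel>\<^sub>L Tout y) (Const Delta)"
| M5: "acp_axiom \<gamma> (Delay x \<parallel>\<^sub>L (Tout y \<oplus> Delay z)) (Delay (x \<parallel>\<^sub>L z))"
| M6: "acp_axiom \<gamma> ((x \<oplus> y) \<parallel>\<^sub>L z) (x \<parallel>\<^sub>L z \<oplus> y \<parallel>\<^sub>L z)"
| C1: "acp_axiom \<gamma> ((Const a \<odot> x) \<parallel>\<^sub>C Const b) ((Const a \<parallel>\<^sub>C Const b) \<odot> x)"
| C2: "acp_axiom \<gamma> (Const a \<parallel>\<^sub>C (Const b \<odot> x)) ((Const a \<parallel>\<^sub>C Const b) \<odot> x)"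
| C3: "acp_axiom \<gamma> ((Const a \<odot> x) \<parallel>\<^sub>C (Const b \<odot> y)) ((Const a \<parallel>\<^sub>C Const b) \<odot> (x \<parallel> y))"
| C4: "acp_axiom \<gamma> (Tout x \<parallel>\<^sub>C Delay y) (Const Delta)"
| C5: "acp_axiom \<gamma> (Delay x \<parallel>\<^sub>C Tout y) (Const Delta)"
| C6: "acp_axiom \<gamma> (Delay x \<parallel>\<^sub>C Delay y) (Delay (x \<parallel>\<^sub>C y))"
| C7: "acp_axiom \<gamma> ((x \<oplus> y) \<parallel>\<^sub>C z) (x \<parallel>\<^sub>C z \<oplus> y \<parallel>\<^sub>C z)"
| C8: "acp_axiom \<gamma> (x \<parallel>\<^sub>C (y \<oplus> z)) (x \<parallel>\<^sub>C y \<oplus> x \<parallel>\<^sub>C z)"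
| C9: "\<gamma> a b = c \<Longrightarrow> acp_axiom \<gamma> (Const a \<parallel>\<^sub>C Const b) (Const c)"
| N1: "acp_axiom \<gamma> (Tout (Const a)) (Const a)"
| N2: "acp_axiom \<gamma> (Tout (x \<oplus> y)) (Tout x \<oplus> Tout y)"
| N3: "acp_axiom \<gamma> (Tout (x \<odot> y)) (Tout x \<odot> y)"
| N4: "acp_axiom \<gamma> (Tout (Delay x)) (Const Delta)"
| B1: "acp_axiom \<gamma> (Const a \<odot> Const Tau) (Const a)"
| B2: "acp_axiom \<gamma> (Const a \<odot> (Const Tau \<odot> (Tout x \<oplus> y) \<oplus> Tout x))
                   (Const a \<odot> (Tout x \<oplus> y))"
| B3: "acp_axiom \<gamma> (Const a \<odot> (Const Tau \<odot> (Tout x \<oplus> y) \<oplus> y))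
                   (Const a \<odot> (Tout x \<oplus> y))"
| B4: "acp_axiom \<gamma> (Const a \<odot> (Delay (Const Tau \<odot> x) \<oplus> Tout y))
                   (Const a \<odot> (Delay x \<oplus> Tout y))"

inductive standard_concurrency_axiom :: "'a trm \<Rightarrow> 'a trm \<Rightarrow> bool" where
  "standard_concurrency_axiom (x \<parallel> y) (y \<parallel> x)"
| "standard_concurrency_axiom ((x \<parallel> y) \<parallel> z) (x \<parallel> (y \<parallel> z))"
| "standard_concurrency_axiom ((x \<parallel>\<^sub>L y) \<parallel>\<^sub>L z) (x \<parallel>\<^sub>L (y \<parallel> z))"
| "standard_concurrency_axiom (x \<parallel>\<^sub>C y) (y \<parallel>\<^sub>C x)"
| "standard_concurrency_axiom ((x \<parallel>\<^sub>C y) \<parallel>\<^sub>C z) (x \<parallel>\<^sub>C (y \<parallel>\<^sub>C z))"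
| "standard_concurrency_axiom (x \<parallel>\<^sub>C (y \<parallel>\<^sub>L z)) ((x \<parallel>\<^sub>C y) \<parallel>\<^sub>L z)"

inductive handshaking_axiom :: "'a trm \<Rightarrow> 'a trm \<Rightarrow> bool" where
  "handshaking_axiom (Tout ((x \<parallel>\<^sub>C y) \<parallel>\<^sub>C z)) (Const Delta)"

inductive derivable :: "'a set \<Rightarrow> ('a act \<Rightarrow> 'a act \<Rightarrow> 'a act) \<Rightarrow> 'a trm \<Rightarrow> 'a trm \<Rightarrow> bool"
  for A \<gamma> where
  ax: "\<lbrakk>acp_axiom \<gamma> s t \<or> standard_concurrency_axiom s t \<or> handshaking_axiom s t;
        wf_trm A s; wf_trm A t\<rbrakk> \<Longrightarrow> derivable A \<gamma> s t"
| refl: "wf_trm A t \<Longrightarrow> derivable A \<gamma> t t"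
| sym: "derivable A \<gamma> s t \<Longrightarrow> derivable A \<gamma> t s"
| trans: "\<lbrakk>derivable A \<gamma> s t; derivable A \<gamma> t u\<rbrakk> \<Longrightarrow> derivable A \<gamma> s u"
| cong_Alt: "\<lbrakk>derivable A \<gamma> s s'; derivable A \<gamma> t t'\<rbrakk> \<Longrightarrow> derivable A \<gamma> (s \<oplus> t) (s' \<oplus> t')"
| cong_Seq: "\<lbrakk>derivable A \<gamma> s s'; derivable A \<gamma> t t'\<rbrakk> \<Longrightarrow> derivable A \<gamma> (s \<odot> t) (s' \<odot> t')"
| cong_Par: "\<lbrakk>derivable A \<gamma> s s'; derivable A \<gamma> t t'\<rbrakk> \<Longrightarrow> derivable A \<gamma> (s \<parallel> t) (s' \<parallel> t')"
| cong_LMerge: "\<lbrakk>derivable A \<gamma> s s'; derivable A \<gamma> t t'\<rbrakk> \<Longrightarrow> derivable A \<gamma> (s \<parallel>\<^sub>L t) (s' \<parallel>\<^sub>L t')"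
| cong_CMerge: "\<lbrakk>derivable A \<gamma> s s'; derivable A \<gamma> t t'\<rbrakk> \<Longrightarrow> derivable A \<gamma> (s \<parallel>\<^sub>C t) (s' \<parallel>\<^sub>C t')"
| cong_Delay: "derivable A \<gamma> s t \<Longrightarrow> derivable A \<gamma> (Delay s) (Delay t)"
| cong_Encap: "\<lbrakk>H \<subseteq> A; derivable A \<gamma> s t\<rbrakk> \<Longrightarrow> derivable A \<gamma> (Encap H s) (Encap H t)"
| cong_Abstr: "\<lbrakk>I \<subseteq> A; derivable A \<gamma> s t\<rbrakk> \<Longrightarrow> derivable A \<gamma> (Abstr I s) (Abstr I t)"
| cong_Tout: "derivable A \<gamma> s t \<Longrightarrow> derivable A \<gamma> (Tout s) (Tout t)"

fun alt_list :: "'a trm list \<Rightarrow> 'a trm" where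
  "alt_list [] = Const Delta"
| "alt_list [t] = t"
| "alt_list (t # u # ts) = t \<oplus> alt_list (u # ts)"

text \<open>The value for the empty list is junk: only nonempty parallel compositions are used.\<close>

fun par_list :: "'a trm list \<Rightarrow> 'a trm" where
  "par_list [] = Const Delta"
| "par_list [t] = t"
| "par_list (t # u # ts) = t \<parallel> par_list (u # ts)"

definition expansion_lhs :: "nat \<Rightarrow> (nat \<Rightarrow> 'a trm) \<Rightarrow> 'a trm" where
  "expansion_lhs n x = par_list [x i. i \<leftarrow> [1..<Suc n]]"

definition expansion_rhs :: "nat \<Rightarrow> (nat \<Rightarrow> 'a trm) \<Rightarrow> 'a trm" where
  "expansion_rhs n x =
     alt_list [x i \<parallel>\<^sub>L par_list [x j. j \<leftarrow> [1..<Suc n], j \<noteq> i]. i \<leftarrow> [1..<Suc n]] \<oplus>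
     alt_list [(x i \<parallel>\<^sub>C x j) \<parallel>\<^sub>L par_list [x k. k \<leftarrow> [1..<Suc n], k \<noteq> i, k \<noteq> j].
                 i \<leftarrow> [1..<Suc n], j \<leftarrow> [Suc i..<Suc n]]"

text \<open>
  The expansion equation has to be read as the scheme of its closed instances. With process
  variables for the \<open>x i\<close> it is not derivable: the axioms do not make an arbitrary \<open>x\<close> a sum of
  \<open>Tout x\<close> and a delayed process, so the handshaking axiom says nothing about
  \<open>(x \<parallel>\<^sub>C y) \<parallel>\<^sub>C z\<close> itself. The following two-element algebra is a model of all axioms that
  refutes the equation between open terms.
\<close>

primrec two_elem :: "'a trm \<Rightarrow> bool" where
  "two_elem (Var v) \<longleftrightarrow> True"
| "two_elem (Const a) \<longleftrightarrow> False"
| "two_elem (x \<oplus> y) \<longleftrightarrow> two_elem x \<or> two_elem y"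
| "two_elem (x \<odot> y) \<longleftrightarrow> False"
| "two_elem (x \<parallel> y) \<longleftrightarrow> two_elem x \<and> two_elem y"
| "two_elem (x \<parallel>\<^sub>L y) \<longleftrightarrow> False"
| "two_elem (x \<parallel>\<^sub>C y) \<longleftrightarrow> two_elem x \<and> two_elem y"
| "two_elem (Delay x) \<longleftrightarrow> False"
| "two_elem (Encap H x) \<longleftrightarrow> False"
| "two_elem (Abstr I x) \<longleftrightarrow> False"
| "two_elem (Tout x) \<longleftrightarrow> False"

lemma two_elem_sound: "derivable A \<gamma> s t \<Longrightarrow> two_elem s = two_elem t"
proof (induction rule: derivable.induct)
  case (ax s t)
  then show ?case
    by (auto elim!: acp_axiom.cases standard_concurrency_axiom.cases handshaking_axiom.cases)
qed auto

lemma two_elem_alt_list: "two_elem (alt_list ts) \<longleftrightarrow> (\<exists>t \<in> set ts. two_elem t)"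
  by (induction ts rule: alt_list.induct) auto

lemma two_elem_par_list: "ts \<noteq> [] \<Longrightarrow> two_elem (par_list ts) \<longleftrightarrow> (\<forall>t \<in> set ts. two_elem t)"
  by (induction ts rule: par_list.induct) auto

lemma open_expansion_not_derivable:
  assumes "n > 2"
  shows "\<not> derivable A \<gamma> (expansion_lhs n Var) (expansion_rhs n Var)"
proof
  assume "derivable A \<gamma> (expansion_lhs n Var) (expansion_rhs n Var)"
  then have "two_elem (expansion_lhs n (Var :: nat \<Rightarrow> 'a trm))
               = two_elem (expansion_rhs n (Var :: nat \<Rightarrow> 'a trm))"
    by (rule two_elem_sound)
  moreover have "two_elem (expansion_lhs n (Var :: nat \<Rightarrow> 'a trm))"
    using assms by (auto simp: expansion_lhs_def two_elem_par_list)
  moreover have "\<not> two_elem (expansion_rhs n (Var :: nat \<Rightarrow> 'a trm))"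
    by (auto simp: expansion_rhs_def two_elem_alt_list)
  ultimately show False by simp
qed

end

theory Submission
  imports Defs
begin

text \<open>
  Every closed term is a sum of terms \<open>a\<close> and \<open>a \<cdot> t\<close>, possibly plus a delayed term of the same
  kind. For such terms the handshaking axiom does not give \<open>x | y | z = \<delta>\<close>, because
  \<open>\<sigma>(\<delta>)\<close> differs from \<open>\<delta>\<close>; it does give that \<open>x | y | z\<close> is a summand of the left merge of
  \<open>x | y\<close> with \<open>z\<close>, since both sides can idle equally long. The expansion then follows by
  induction on the number of components: unfolding \<open>x \<parallel> P\<close> for an expanded \<open>P\<close> yields the expected summands
  and ternary communications, and the latter are absorbed by binary ones.
\<close>

text \<open>Commuting and regrouping of parallel components comes from the standard concurrency
  axioms; the normal forms are there for the absorption of ternary communications. Let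
  \<open>Q\<close> be an expanded composition, and write \<open>R\<close> for the components other
  than \<open>x m\<close>, \<open>x i\<close> and \<open>x j\<close>. In
  \<open>x m \<parallel>\<^sub>C Q\<close> the pair \<open>x i \<parallel>\<^sub>C x j\<close> meets
  \<open>x m\<close>, and the result is no summand of the goal. It is bounded by one: \<open>((x m
  \<parallel>\<^sub>C x i) \<parallel>\<^sub>C x j) \<parallel>\<^sub>L R\<close> is a summand of
  \<open>((x m \<parallel>\<^sub>C x i) \<parallel>\<^sub>L x j) \<parallel>\<^sub>L R\<close>,
  which equals \<open>(x m \<parallel>\<^sub>C x i) \<parallel>\<^sub>L (x j \<parallel> R)\<close>.
  Only an inclusion is available at that point, so the proof works with the order of the semilattice
  \<open>\<oplus>\<close> and obtains equations by antisymmetry. The inclusion holds slice by slice: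
  C4 and C5 remove communications between present and delayed parts, handshaking removes those of
  three present parts, and C6 moves what remains into the next slice, just as M5 does for the left
  merge.\<close>

locale acp_signature =
  fixes A :: "'a set" and \<gamma> :: "'a act \<Rightarrow> 'a act \<Rightarrow> 'a act"
  assumes gamma_closed: "\<And>a b. \<lbrakk>a \<in> acts A; b \<in> acts A\<rbrakk> \<Longrightarrow> \<gamma> a b \<in> acts A"
begin

abbreviation wf :: "'a trm \<Rightarrow> bool" where
  "wf \<equiv> wf_trm A"

abbreviation eqv :: "'a trm \<Rightarrow> 'a trm \<Rightarrow> bool" (infix \<open>\<approx>\<close> 50) where
  "s \<approx> t \<equiv> derivable A \<gamma> s t"

section \<open>Equational rules of the theory\<close>

lemma Delta_acts [simp]: "Delta \<in> acts A"
  and Tau_acts [simp]: "Tau \<in> acts A"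
  by (simp_all add: acts_def)

lemma eqv_wf: "s \<approx> t \<Longrightarrow> wf s \<and> wf t"
  by (induction rule: derivable.induct) auto

lemmas eqv_wf2 = eqv_wf [THEN conjunct2]

lemmas eqv_refl = derivable.refl [of A _ \<gamma>]
  and eqv_sym = derivable.sym [of A \<gamma>]
  and eqv_trans [trans] = derivable.trans [of A \<gamma>]
  and Alt_cong = derivable.cong_Alt [of A \<gamma>]
  and Seq_cong = derivable.cong_Seq [of A \<gamma>]
  and Par_cong = derivable.cong_Par [of A \<gamma>]
  and LMerge_cong = derivable.cong_LMerge [of A \<gamma>]
  and CMerge_cong = derivable.cong_CMerge [of A \<gamma>]
  and Delay_cong = derivable.cong_Delay [of A \<gamma>]
  and Encap_cong = derivable.cong_Encap [of _ A \<gamma>]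
  and Abstr_cong = derivable.cong_Abstr [of _ A \<gamma>]
  and Tout_cong = derivable.cong_Tout [of A \<gamma>]

lemma acp: "\<lbrakk>acp_axiom \<gamma> s t; wf s; wf t\<rbrakk> \<Longrightarrow> s \<approx> t"
  by (rule derivable.ax) auto

lemma acp_sym: "\<lbrakk>acp_axiom \<gamma> s t; wf s; wf t\<rbrakk> \<Longrightarrow> t \<approx> s"
  by (rule eqv_sym [OF acp])

lemma Par_commute: "\<lbrakk>wf x; wf y\<rbrakk> \<Longrightarrow> x \<parallel> y \<approx> y \<parallel> x"
  and Par_assoc: "\<lbrakk>wf x; wf y; wf z\<rbrakk> \<Longrightarrow> (x \<parallel> y) \<parallel> z \<approx> x \<parallel> (y \<parallel> z)"
  and LMerge_LMerge: "\<lbrakk>wf x; wf y; wf z\<rbrakk> \<Longrightarrow> (x \<parallel>\<^sub>L y) \<parallel>\<^sub>L z \<approx> x \<parallel>\<^sub>L (y \<parallel> z)"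
  and CMerge_commute: "\<lbrakk>wf x; wf y\<rbrakk> \<Longrightarrow> x \<parallel>\<^sub>C y \<approx> y \<parallel>\<^sub>C x"
  and CMerge_assoc: "\<lbrakk>wf x; wf y; wf z\<rbrakk> \<Longrightarrow> (x \<parallel>\<^sub>C y) \<parallel>\<^sub>C z \<approx> x \<parallel>\<^sub>C (y \<parallel>\<^sub>C z)"
  and CMerge_LMerge: "\<lbrakk>wf x; wf y; wf z\<rbrakk> \<Longrightarrow> x \<parallel>\<^sub>C (y \<parallel>\<^sub>L z) \<approx> (x \<parallel>\<^sub>C y) \<parallel>\<^sub>L z"
  by (rule derivable.ax; simp add: standard_concurrency_axiom.intros)+

lemma handshaking: "\<lbrakk>wf x; wf y; wf z\<rbrakk> \<Longrightarrow> Tout ((x \<parallel>\<^sub>C y) \<parallel>\<^sub>C z) \<approx> Const Delta"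
  by (rule derivable.ax) (simp_all add: handshaking_axiom.intros)

lemma Alt_Delta: "wf x \<Longrightarrow> x \<oplus> Const Delta \<approx> x"
  by (rule acp [OF A6]) auto

lemma Delta_Alt: "wf x \<Longrightarrow> Const Delta \<oplus> x \<approx> x"
  by (rule eqv_trans [OF acp [OF A1] Alt_Delta]) auto

lemma Alt_swap:
  assumes "wf a" "wf b" "wf c" "wf d"
  shows "(a \<oplus> b) \<oplus> (c \<oplus> d) \<approx> (a \<oplus> c) \<oplus> (b \<oplus> d)"
proof -
  have "(a \<oplus> b) \<oplus> (c \<oplus> d) \<approx> a \<oplus> (b \<oplus> (c \<oplus> d))"
    by (rule acp [OF A2]) (use assms in auto)
  also have "\<dots> \<approx> a \<oplus> ((b \<oplus> c) \<oplus> d)"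
    by (intro Alt_cong eqv_refl acp_sym [OF A2]) (use assms in auto)
  also have "\<dots> \<approx> a \<oplus> ((c \<oplus> b) \<oplus> d)"
    by (intro Alt_cong eqv_refl acp [OF A1]) (use assms in auto)
  also have "\<dots> \<approx> a \<oplus> (c \<oplus> (b \<oplus> d))"
    by (intro Alt_cong eqv_refl acp [OF A2]) (use assms in auto)
  also have "\<dots> \<approx> (a \<oplus> c) \<oplus> (b \<oplus> d)"
    by (rule acp_sym [OF A2]) (use assms in auto)
  finally show ?thesis .
qed


subsection \<open>Summands\<close>

text \<open>The order of the semilattice given by A1 to A3, up to derivability:
  \<open>\<oplus>\<close> is the join and, by A6, \<open>Const Delta\<close> is the bottom. In this
  order a long sum behaves like the set of its entries, whatever their sequence and
  bracketing.\<close>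

definition summand :: "'a trm \<Rightarrow> 'a trm \<Rightarrow> bool" (infix \<open>\<sqsubseteq>\<close> 50) where
  "s \<sqsubseteq> t \<longleftrightarrow> t \<oplus> s \<approx> t"

lemma summand_wf: "s \<sqsubseteq> t \<Longrightarrow> wf s \<and> wf t"
  unfolding summand_def using eqv_wf by fastforce

lemma summand_eqv: "\<lbrakk>s \<approx> s'; s' \<sqsubseteq> t\<rbrakk> \<Longrightarrow> s \<sqsubseteq> t"
  unfolding summand_def
  by (rule eqv_trans [OF Alt_cong [OF eqv_refl]]) (auto dest: eqv_wf)

lemma eqv_summand: "\<lbrakk>s \<sqsubseteq> t; t \<approx> t'\<rbrakk> \<Longrightarrow> s \<sqsubseteq> t'"
proof -
  assume *: "s \<sqsubseteq> t" "t \<approx> t'"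
  then have "wf s" by (auto dest: summand_wf)
  then have "t' \<oplus> s \<approx> t \<oplus> s"
    by (intro Alt_cong eqv_refl eqv_sym [OF *(2)])
  also have "\<dots> \<approx> t" using *(1) by (simp add: summand_def)
  also note *(2)
  finally show ?thesis by (simp add: summand_def)
qed

lemma summand_refl: "s \<approx> t \<Longrightarrow> s \<sqsubseteq> t"
  using eqv_wf2 [of s t] by (auto intro: summand_eqv simp: summand_def [of t t] acp [OF A3])

lemma summand_trans: "\<lbrakk>s \<sqsubseteq> t; t \<sqsubseteq> u\<rbrakk> \<Longrightarrow> s \<sqsubseteq> u"
proof -
  assume *: "s \<sqsubseteq> t" "t \<sqsubseteq> u"
  then have wf: "wf s" "wf t" "wf u" by (auto dest: summand_wf)
  have "u \<oplus> s \<approx> (u \<oplus> t) \<oplus> s"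
    using * wf by (intro Alt_cong eqv_refl eqv_sym [of "u \<oplus> t"]) (simp_all add: summand_def)
  also have "\<dots> \<approx> u \<oplus> (t \<oplus> s)" by (rule acp [OF A2]) (use wf in auto)
  also have "\<dots> \<approx> u \<oplus> t"
    using * wf by (intro Alt_cong eqv_refl) (simp_all add: summand_def)
  also have "\<dots> \<approx> u" using * by (simp add: summand_def)
  finally show ?thesis by (simp add: summand_def)
qed

lemma summand_antisym: "\<lbrakk>s \<sqsubseteq> t; t \<sqsubseteq> s\<rbrakk> \<Longrightarrow> s \<approx> t"
proof -
  assume *: "s \<sqsubseteq> t" "t \<sqsubseteq> s"
  then have wf: "wf s" "wf t" by (auto dest: summand_wf)
  have "s \<approx> s \<oplus> t" using *(2) by (intro eqv_sym [of "s \<oplus> t"]) (simp add: summand_def)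
  also have "\<dots> \<approx> t \<oplus> s" by (rule acp [OF A1]) (use wf in auto)
  also have "\<dots> \<approx> t" using *(1) by (simp add: summand_def)
  finally show ?thesis .
qed

lemma Delta_summand: "wf t \<Longrightarrow> Const Delta \<sqsubseteq> t"
  by (simp add: summand_def Alt_Delta)

lemma Alt_summand: "\<lbrakk>s \<sqsubseteq> u; t \<sqsubseteq> u\<rbrakk> \<Longrightarrow> s \<oplus> t \<sqsubseteq> u"
proof -
  assume *: "s \<sqsubseteq> u" "t \<sqsubseteq> u"
  then have wf: "wf s" "wf t" "wf u" by (auto dest: summand_wf)
  have "u \<oplus> (s \<oplus> t) \<approx> (u \<oplus> s) \<oplus> t" by (rule acp_sym [OF A2]) (use wf in auto)
  also have "\<dots> \<approx> u \<oplus> t"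
    using * wf by (intro Alt_cong eqv_refl) (simp_all add: summand_def)
  also have "\<dots> \<approx> u" using * by (simp add: summand_def)
  finally show ?thesis by (simp add: summand_def)
qed

lemma summand_Alt2: "\<lbrakk>wf s; wf t\<rbrakk> \<Longrightarrow> t \<sqsubseteq> s \<oplus> t"
  unfolding summand_def
  by (rule eqv_trans [OF acp [OF A2] Alt_cong [OF eqv_refl acp [OF A3]]]) auto

lemma summand_Alt1: "\<lbrakk>wf s; wf t\<rbrakk> \<Longrightarrow> s \<sqsubseteq> s \<oplus> t"
  by (rule eqv_summand [OF summand_Alt2 [of t s] acp [OF A1]]) auto

text \<open>M6 distributes the left merge over sums in its first argument only, hence monotonicity
  in that argument alone; C7 and C8 give both arguments for the communication merge.\<close>

lemma LMerge_mono: "\<lbrakk>s \<sqsubseteq> t; wf z\<rbrakk> \<Longrightarrow> s \<parallel>\<^sub>L z \<sqsubseteq> t \<parallel>\<^sub>L z"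
  unfolding summand_def
  by (rule eqv_trans [OF acp_sym [OF M6] LMerge_cong]) (auto intro: eqv_refl dest: eqv_wf)

lemma CMerge_mono: "\<lbrakk>s \<sqsubseteq> t; wf z\<rbrakk> \<Longrightarrow> z \<parallel>\<^sub>C s \<sqsubseteq> z \<parallel>\<^sub>C t"
  unfolding summand_def
  by (rule eqv_trans [OF acp_sym [OF C8] CMerge_cong]) (auto intro: eqv_refl dest: eqv_wf)

lemma CMerge_mono1: "\<lbrakk>s \<sqsubseteq> t; wf z\<rbrakk> \<Longrightarrow> s \<parallel>\<^sub>C z \<sqsubseteq> t \<parallel>\<^sub>C z"
  unfolding summand_def
  by (rule eqv_trans [OF acp_sym [OF C7] CMerge_cong]) (auto intro: eqv_refl dest: eqv_wf)

lemma Delay_mono: "s \<sqsubseteq> t \<Longrightarrow> Delay s \<sqsubseteq> Delay t"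
  unfolding summand_def
  by (rule eqv_trans [OF acp [OF S1] Delay_cong]) (auto dest: eqv_wf)


subsection \<open>Terms without initial delay\<close>

text \<open>Sums of terms whose first step lies in the current slice. The continuation after an
  action is arbitrary, because neither \<open>Tout\<close> nor handshaking looks past that action.
  Closure under derivable equality lets each operator be handled by rewriting with its own
  axioms.\<close>

inductive imm :: "'a trm \<Rightarrow> bool" where
  imm_Const: "a \<in> acts A \<Longrightarrow> imm (Const a)"
| imm_Const_Seq: "\<lbrakk>a \<in> acts A; wf t\<rbrakk> \<Longrightarrow> imm (Const a \<odot> t)"
| imm_Alt: "\<lbrakk>imm s; imm t\<rbrakk> \<Longrightarrow> imm (s \<oplus> t)"
| imm_eqv: "\<lbrakk>imm s; s \<approx> t\<rbrakk> \<Longrightarrow> imm t"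

lemma imm_wf: "imm t \<Longrightarrow> wf t"
  by (induction rule: imm.induct) (auto dest: eqv_wf)

lemma eqv_imm: "\<lbrakk>s \<approx> t; imm t\<rbrakk> \<Longrightarrow> imm s"
  by (blast intro: imm_eqv eqv_sym)

text \<open>The axioms on time slices (M4, M5, C4, C5) and handshaking are stated with
  \<open>Tout\<close>; this equation makes them applicable to immediate terms, where no
  \<open>Tout\<close> is visible.\<close>

lemma Tout_imm: "imm t \<Longrightarrow> Tout t \<approx> t"
proof (induction rule: imm.induct)
  case (imm_Const a)
  then show ?case by (auto intro: acp [OF N1])
next
  case (imm_Const_Seq a t)
  then show ?case
    by (intro eqv_trans [OF acp [OF N3] Seq_cong [OF acp [OF N1] eqv_refl]]) auto
next
  case (imm_Alt s t)
  then show ?case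
    by (intro eqv_trans [OF acp [OF N2] Alt_cong]) (auto dest: imm_wf)
next
  case (imm_eqv s t)
  then show ?case by (meson eqv_sym eqv_trans Tout_cong)
qed

lemma imm_Seq: "\<lbrakk>imm s; wf y\<rbrakk> \<Longrightarrow> imm (s \<odot> y)"
proof (induction rule: imm.induct)
  case (imm_Const a)
  then show ?case by (simp add: imm.imm_Const_Seq)
next
  case (imm_Const_Seq a t)
  then show ?case
    by (intro eqv_imm [OF acp [OF A5]] imm.imm_Const_Seq) auto
next
  case (imm_Alt s t)
  then show ?case
    by (intro eqv_imm [OF acp [OF A4]] imm.imm_Alt) (auto dest: imm_wf)
next
  case (imm_eqv s t)
  then show ?case by (meson imm.imm_eqv eqv_refl Seq_cong)
qed

text \<open>By M2 and M3 the right operand ends up behind the first action of the left one, so it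
  may be any well-formed term.\<close>

lemma imm_LMerge: "\<lbrakk>imm s; wf y\<rbrakk> \<Longrightarrow> imm (s \<parallel>\<^sub>L y)"
proof (induction rule: imm.induct)
  case (imm_Const a)
  then show ?case
    by (intro eqv_imm [OF acp [OF M2]] imm.imm_Const_Seq) auto
next
  case (imm_Const_Seq a t)
  then show ?case
    by (intro eqv_imm [OF acp [OF M3]] imm.imm_Const_Seq) auto
next
  case (imm_Alt s t)
  then show ?case
    by (intro eqv_imm [OF acp [OF M6]] imm.imm_Alt) (auto dest: imm_wf)
next
  case (imm_eqv s t)
  then show ?case by (meson imm.imm_eqv eqv_refl LMerge_cong)
qed

lemma Encap_Const:
  assumes "a \<in> acts A" "H \<subseteq> A"
  obtains b where "b \<in> acts A" "Encap H (Const a) \<approx> Const b"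
proof (cases "a \<in> Act ` H")
  case True
  then show ?thesis using assms by (intro that [of Delta] acp [OF D2]) auto
next
  case False
  then show ?thesis using assms by (intro that [of a] acp [OF D1]) auto
qed

lemma Abstr_Const:
  assumes "a \<in> acts A" "I \<subseteq> A"
  obtains b where "b \<in> acts A" "Abstr I (Const a) \<approx> Const b"
proof (cases "a \<in> Act ` I")
  case True
  then show ?thesis using assms by (intro that [of Tau] acp [OF T2]) auto
next
  case False
  then show ?thesis using assms by (intro that [of a] acp [OF T1]) auto
qed

lemma imm_Encap: "\<lbrakk>imm s; H \<subseteq> A\<rbrakk> \<Longrightarrow> imm (Encap H s)"
proof (induction rule: imm.induct)
  case (imm_Const a)
  then show ?case by (meson Encap_Const eqv_imm imm.imm_Const)
next
  case (imm_Const_Seq a t)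
  then have "Encap H (Const a \<odot> t) \<approx> Encap H (Const a) \<odot> Encap H t"
    by (intro acp [OF D4]) auto
  moreover have "imm (Encap H (Const a))"
    using imm_Const_Seq by (meson Encap_Const eqv_imm imm.imm_Const)
  ultimately show ?case
    using imm_Const_Seq by (simp add: eqv_imm [OF _ imm_Seq])
next
  case (imm_Alt s t)
  then show ?case
    by (intro eqv_imm [OF acp [OF D3]] imm.imm_Alt) (auto dest: imm_wf)
next
  case (imm_eqv s t)
  then show ?case by (meson imm.imm_eqv Encap_cong)
qed

lemma imm_Abstr: "\<lbrakk>imm s; I \<subseteq> A\<rbrakk> \<Longrightarrow> imm (Abstr I s)"
proof (induction rule: imm.induct)
  case (imm_Const a)
  then show ?case by (meson Abstr_Const eqv_imm imm.imm_Const)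
next
  case (imm_Const_Seq a t)
  then have "Abstr I (Const a \<odot> t) \<approx> Abstr I (Const a) \<odot> Abstr I t"
    by (intro acp [OF T4]) auto
  moreover have "imm (Abstr I (Const a))"
    using imm_Const_Seq by (meson Abstr_Const eqv_imm imm.imm_Const)
  ultimately show ?case
    using imm_Const_Seq by (simp add: eqv_imm [OF _ imm_Seq])
next
  case (imm_Alt s t)
  then show ?case
    by (intro eqv_imm [OF acp [OF T3]] imm.imm_Alt) (auto dest: imm_wf)
next
  case (imm_eqv s t)
  then show ?case by (meson imm.imm_eqv Abstr_cong)
qed

text \<open>Closure of \<open>\<gamma>\<close> enters here: the constant that C9 produces has to be
  well-formed over \<open>A\<close>.\<close>

lemma imm_CMerge_Const: "\<lbrakk>a \<in> acts A; b \<in> acts A\<rbrakk> \<Longrightarrow> imm (Const a \<parallel>\<^sub>C Const b)"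
  by (intro eqv_imm [OF acp [OF C9 [OF HOL.refl]]] imm_Const) (auto simp: gamma_closed)

text \<open>C1 to C3 speak of the shapes of both operands at once. The induction is therefore split:
  on the right operand for each shape of a single left summand, and then on the left operand in
  \<open>imm_CMerge\<close>.\<close>

lemma imm_Const_CMerge: "\<lbrakk>imm t; a \<in> acts A\<rbrakk> \<Longrightarrow> imm (Const a \<parallel>\<^sub>C t)"
proof (induction rule: imm.induct)
  case (imm_Const b)
  then show ?case by (simp add: imm_CMerge_Const)
next
  case (imm_Const_Seq b t)
  then show ?case
    by (intro eqv_imm [OF acp [OF C2]] imm_Seq imm_CMerge_Const) auto
next
  case (imm_Alt s t)
  then show ?case
    by (intro eqv_imm [OF acp [OF C8]] imm.imm_Alt) (auto dest: imm_wf)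
next
  case (imm_eqv s t)
  then show ?case by (meson imm.imm_eqv eqv_refl CMerge_cong wf_trm.simps(2))
qed

lemma imm_Const_Seq_CMerge: "\<lbrakk>imm t; a \<in> acts A; wf s\<rbrakk> \<Longrightarrow> imm ((Const a \<odot> s) \<parallel>\<^sub>C t)"
proof (induction rule: imm.induct)
  case (imm_Const b)
  then show ?case
    by (intro eqv_imm [OF acp [OF C1]] imm_Seq imm_CMerge_Const) auto
next
  case (imm_Const_Seq b t)
  then show ?case
    by (intro eqv_imm [OF acp [OF C3]] imm_Seq imm_CMerge_Const) auto
next
  case (imm_Alt s t)
  then show ?case
    by (intro eqv_imm [OF acp [OF C8]] imm.imm_Alt) (auto dest: imm_wf)
next
  case (imm_eqv s t)
  then show ?case by (meson imm.imm_eqv eqv_refl CMerge_cong wf_trm.simps(2,4))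
qed

lemma imm_CMerge: "\<lbrakk>imm s; imm t\<rbrakk> \<Longrightarrow> imm (s \<parallel>\<^sub>C t)"
proof (induction rule: imm.induct)
  case (imm_Const a)
  then show ?case by (simp add: imm_Const_CMerge)
next
  case (imm_Const_Seq a s)
  then show ?case by (simp add: imm_Const_Seq_CMerge)
next
  case (imm_Alt s s')
  then show ?case
    by (intro eqv_imm [OF acp [OF C7]] imm.imm_Alt) (auto dest: imm_wf)
next
  case (imm_eqv s s')
  then show ?case by (meson imm.imm_eqv eqv_refl CMerge_cong imm_wf)
qed

lemma imm_CMerge_Delay: "\<lbrakk>imm s; wf t\<rbrakk> \<Longrightarrow> s \<parallel>\<^sub>C Delay t \<approx> Const Delta"
  by (rule eqv_trans [OF CMerge_cong [OF eqv_sym [OF Tout_imm] eqv_refl] acp [OF C4]])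
    (auto dest: imm_wf)

lemma Delay_CMerge_imm: "\<lbrakk>imm s; wf t\<rbrakk> \<Longrightarrow> Delay t \<parallel>\<^sub>C s \<approx> Const Delta"
  by (rule eqv_trans [OF CMerge_commute imm_CMerge_Delay]) (auto dest: imm_wf)

text \<open>The ternary communication is itself immediate by \<open>imm_CMerge\<close>, so the
  \<open>Tout\<close> in the handshaking axiom can be removed.\<close>

lemma imm_handshaking:
  assumes "imm x" "imm y" "imm z"
  shows "(x \<parallel>\<^sub>C y) \<parallel>\<^sub>C z \<approx> Const Delta"
  by (rule eqv_trans [OF eqv_sym [OF Tout_imm] handshaking])
    (use assms in \<open>auto intro: imm_CMerge dest: imm_wf\<close>)


subsection \<open>Normal forms of closed terms\<close>

text \<open>An absent delay needs its own case and cannot be encoded as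
  \<open>Delay (Const Delta)\<close>: M4 and M5 distinguish a right operand that cannot wait from
  one that can. The nesting depth of the delays is what later inductions run on.\<close>

inductive timed :: "'a trm \<Rightarrow> bool" where
  timed_imm: "imm t \<Longrightarrow> timed t"
| timed_Delay_Alt: "\<lbrakk>imm h; timed u; t \<approx> h \<oplus> Delay u\<rbrakk> \<Longrightarrow> timed t"

lemma timed_wf: "timed t \<Longrightarrow> wf t"
  by (induction rule: timed.induct) (auto dest: imm_wf eqv_wf)

lemma eqv_timed: "\<lbrakk>s \<approx> t; timed t\<rbrakk> \<Longrightarrow> timed s"
  by (erule timed.cases) (blast intro: timed.intros eqv_imm eqv_trans)+

lemma timed_Delay: "timed t \<Longrightarrow> timed (Delay t)"
  by (rule timed_Delay_Alt [of "Const Delta" t])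
    (auto intro!: imm_Const eqv_sym [OF Delta_Alt] dest: timed_wf)

lemma timed_imm_Alt:
  assumes "imm k" "timed t"
  shows "timed (k \<oplus> t)"
  using assms(2)
proof cases
  case timed_imm
  then show ?thesis using assms by (blast intro: timed.timed_imm imm_Alt)
next
  case (timed_Delay_Alt h u)
  have "k \<oplus> t \<approx> k \<oplus> (h \<oplus> Delay u)"
    by (intro Alt_cong eqv_refl timed_Delay_Alt imm_wf assms)
  also have "\<dots> \<approx> (k \<oplus> h) \<oplus> Delay u"
    using timed_Delay_Alt assms by (intro acp_sym [OF A2]) (auto dest: imm_wf timed_wf)
  finally show ?thesis
    using timed_Delay_Alt assms by (blast intro: timed.timed_Delay_Alt imm_Alt)
qed

text \<open>S1 fuses the delays of the two summands into one, whose body is covered by the induction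
  hypothesis.\<close>

lemma timed_Alt: "\<lbrakk>timed s; timed t\<rbrakk> \<Longrightarrow> timed (s \<oplus> t)"
proof (induction arbitrary: t rule: timed.induct)
  case (timed_imm s)
  then show ?case by (simp add: timed_imm_Alt)
next
  case (timed_Delay_Alt h u s)
  note s = timed_Delay_Alt
  note wfs = imm_wf [OF s(1)] timed_wf [OF s(2)] timed_wf [OF s(5)]
  from s(5) show ?case
  proof cases
    case timed_imm
    have "s \<oplus> t \<approx> t \<oplus> s"
      using s by (intro acp [OF A1]) (auto dest: timed_wf eqv_wf)
    moreover have "timed s"
      using s by (blast intro: timed.timed_Delay_Alt)
    ultimately show ?thesis
      using timed_imm by (blast intro: eqv_timed timed_imm_Alt)
  next
    case (timed_Delay_Alt k v)
    note wfs = wfs imm_wf [OF timed_Delay_Alt(1)] timed_wf [OF timed_Delay_Alt(2)]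
    have "s \<oplus> t \<approx> (h \<oplus> Delay u) \<oplus> (k \<oplus> Delay v)"
      by (intro Alt_cong s timed_Delay_Alt)
    also have "\<dots> \<approx> (h \<oplus> k) \<oplus> (Delay u \<oplus> Delay v)"
      by (rule Alt_swap) (simp_all add: wfs)
    also have "\<dots> \<approx> (h \<oplus> k) \<oplus> Delay (u \<oplus> v)"
      by (intro Alt_cong eqv_refl acp [OF S1]) (simp_all add: wfs)
    finally show ?thesis
      using s timed_Delay_Alt by (blast intro: timed.timed_Delay_Alt imm_Alt)
  qed
qed

lemma timed_Seq: "\<lbrakk>timed s; wf y\<rbrakk> \<Longrightarrow> timed (s \<odot> y)"
proof (induction rule: timed.induct)
  case (timed_imm s)
  then show ?case by (blast intro: timed.timed_imm imm_Seq)
next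
  case (timed_Delay_Alt h u s)
  note wfs = imm_wf [OF timed_Delay_Alt(1)] timed_wf [OF timed_Delay_Alt(2)]
  have "s \<odot> y \<approx> (h \<oplus> Delay u) \<odot> y"
    by (intro Seq_cong timed_Delay_Alt eqv_refl)
  also have "\<dots> \<approx> h \<odot> y \<oplus> Delay u \<odot> y"
    by (rule acp [OF A4]) (simp_all add: wfs timed_Delay_Alt)
  also have "\<dots> \<approx> h \<odot> y \<oplus> Delay (u \<odot> y)"
    by (intro Alt_cong eqv_refl acp [OF S2]) (simp_all add: wfs timed_Delay_Alt)
  finally show ?case
    using timed_Delay_Alt by (blast intro: timed.timed_Delay_Alt imm_Seq)
qed

lemma timed_Encap: "\<lbrakk>timed s; H \<subseteq> A\<rbrakk> \<Longrightarrow> timed (Encap H s)"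
proof (induction rule: timed.induct)
  case (timed_imm s)
  then show ?case by (blast intro: timed.timed_imm imm_Encap)
next
  case (timed_Delay_Alt h u s)
  note wfs = imm_wf [OF timed_Delay_Alt(1)] timed_wf [OF timed_Delay_Alt(2)]
  have "Encap H s \<approx> Encap H (h \<oplus> Delay u)"
    by (intro Encap_cong timed_Delay_Alt)
  also have "\<dots> \<approx> Encap H h \<oplus> Encap H (Delay u)"
    by (rule acp [OF D3]) (simp_all add: wfs timed_Delay_Alt)
  also have "\<dots> \<approx> Encap H h \<oplus> Delay (Encap H u)"
    by (intro Alt_cong eqv_refl acp [OF D5]) (simp_all add: wfs timed_Delay_Alt)
  finally show ?case
    using timed_Delay_Alt by (blast intro: timed.timed_Delay_Alt imm_Encap)
qed

lemma timed_Abstr: "\<lbrakk>timed s; I \<subseteq> A\<rbrakk> \<Longrightarrow> timed (Abstr I s)"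
proof (induction rule: timed.induct)
  case (timed_imm s)
  then show ?case by (blast intro: timed.timed_imm imm_Abstr)
next
  case (timed_Delay_Alt h u s)
  note wfs = imm_wf [OF timed_Delay_Alt(1)] timed_wf [OF timed_Delay_Alt(2)]
  have "Abstr I s \<approx> Abstr I (h \<oplus> Delay u)"
    by (intro Abstr_cong timed_Delay_Alt)
  also have "\<dots> \<approx> Abstr I h \<oplus> Abstr I (Delay u)"
    by (rule acp [OF T3]) (simp_all add: wfs timed_Delay_Alt)
  also have "\<dots> \<approx> Abstr I h \<oplus> Delay (Abstr I u)"
    by (intro Alt_cong eqv_refl acp [OF T5]) (simp_all add: wfs timed_Delay_Alt)
  finally show ?case
    using timed_Delay_Alt by (blast intro: timed.timed_Delay_Alt imm_Abstr)
qed

lemma timed_Tout: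
  assumes "timed s"
  shows "timed (Tout s)"
  using assms
proof cases
  case timed_imm
  then show ?thesis by (blast intro: timed.timed_imm eqv_imm Tout_imm)
next
  case (timed_Delay_Alt h u)
  note wfs = imm_wf [OF timed_Delay_Alt(1)] timed_wf [OF timed_Delay_Alt(2)]
  have "Tout s \<approx> Tout (h \<oplus> Delay u)"
    by (intro Tout_cong timed_Delay_Alt)
  also have "\<dots> \<approx> Tout h \<oplus> Tout (Delay u)"
    by (rule acp [OF N2]) (simp_all add: wfs)
  also have "\<dots> \<approx> h \<oplus> Const Delta"
    by (intro Alt_cong Tout_imm timed_Delay_Alt acp [OF N4]) (simp_all add: wfs)
  also have "\<dots> \<approx> h"
    by (simp add: Alt_Delta wfs)
  finally show ?thesis
    using timed_Delay_Alt by (blast intro: timed.timed_imm eqv_imm)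
qed

section \<open>Normal forms under the merge operators\<close>

lemma Delay_LMerge_imm: "\<lbrakk>imm k; wf u\<rbrakk> \<Longrightarrow> Delay u \<parallel>\<^sub>L k \<approx> Const Delta"
  by (rule eqv_trans [OF LMerge_cong [OF eqv_refl eqv_sym [OF Tout_imm]] acp [OF M4]])
    (auto dest: imm_wf)

text \<open>A delayed left operand meets only the delayed part of the right one. M5 applies once the
  immediate part \<open>k\<close> has been rewritten as \<open>Tout k\<close>.\<close>

lemma Delay_LMerge_Delay:
  assumes "imm k" "wf u" "t \<approx> k \<oplus> Delay v"
  shows "Delay u \<parallel>\<^sub>L t \<approx> Delay (u \<parallel>\<^sub>L v)"
proof -
  have wfs: "wf k" "wf v" using eqv_wf2 [OF assms(3)] by auto
  have "t \<approx> Tout k \<oplus> Delay v"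
    by (rule eqv_trans [OF assms(3) Alt_cong [OF eqv_sym [OF Tout_imm] eqv_refl]])
      (simp_all add: wfs assms)
  then have "Delay u \<parallel>\<^sub>L t \<approx> Delay u \<parallel>\<^sub>L (Tout k \<oplus> Delay v)"
    using assms by (intro LMerge_cong eqv_refl) auto
  also have "\<dots> \<approx> Delay (u \<parallel>\<^sub>L v)"
    by (rule acp [OF M5]) (simp_all add: wfs assms)
  finally show ?thesis .
qed

lemma timed_LMerge: "\<lbrakk>timed s; timed t\<rbrakk> \<Longrightarrow> timed (s \<parallel>\<^sub>L t)"
proof (induction arbitrary: t rule: timed.induct)
  case (timed_imm s)
  then show ?case by (blast intro: timed.timed_imm imm_LMerge timed_wf)
next
  case (timed_Delay_Alt h u s)
  note s = timed_Delay_Alt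
  note wfs = imm_wf [OF s(1)] timed_wf [OF s(2)] timed_wf [OF s(5)]
  have "s \<parallel>\<^sub>L t \<approx> (h \<oplus> Delay u) \<parallel>\<^sub>L t"
    by (intro LMerge_cong s eqv_refl wfs)
  also have "\<dots> \<approx> h \<parallel>\<^sub>L t \<oplus> Delay u \<parallel>\<^sub>L t"
    by (rule acp [OF M6]) (simp_all add: wfs)
  finally have eq: "s \<parallel>\<^sub>L t \<approx> h \<parallel>\<^sub>L t \<oplus> Delay u \<parallel>\<^sub>L t" .
  from s(5) have "timed (Delay u \<parallel>\<^sub>L t)"
  proof cases
    case timed_imm
    then show ?thesis
      using wfs by (blast intro: timed.timed_imm imm_Const eqv_imm Delay_LMerge_imm Delta_acts)
  next
    case (timed_Delay_Alt k v)
    then show ?thesis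
      using wfs s by (blast intro: eqv_timed Delay_LMerge_Delay timed_Delay)
  qed
  then show ?case
    using eq s wfs by (blast intro: eqv_timed timed_imm_Alt imm_LMerge)
qed

text \<open>\<open>k\<close> is the immediate part of \<open>t\<close>: by C4 the delayed part
  contributes only \<open>Const Delta\<close> against an immediate partner. As \<open>k\<close> does
  not depend on \<open>s\<close>, it also serves for an \<open>s\<close> that is a
  communication.\<close>

lemma imm_CMerge_timed:
  assumes "timed t"
  obtains k where "imm k" "\<And>s. imm s \<Longrightarrow> s \<parallel>\<^sub>C t \<approx> s \<parallel>\<^sub>C k"
  using assms
proof cases
  case timed_imm
  then show ?thesis by (intro that [of t] eqv_refl) (auto dest: imm_wf)
next
  case (timed_Delay_Alt k v)
  note wfs = imm_wf [OF timed_Delay_Alt(1)] timed_wf [OF timed_Delay_Alt(2)]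
  have "s \<parallel>\<^sub>C t \<approx> s \<parallel>\<^sub>C k" if "imm s" for s
  proof -
    have "s \<parallel>\<^sub>C t \<approx> s \<parallel>\<^sub>C (k \<oplus> Delay v)"
      by (intro CMerge_cong timed_Delay_Alt eqv_refl imm_wf that)
    also have "\<dots> \<approx> s \<parallel>\<^sub>C k \<oplus> s \<parallel>\<^sub>C Delay v"
      by (rule acp [OF C8]) (simp_all add: wfs imm_wf that)
    also have "\<dots> \<approx> s \<parallel>\<^sub>C k \<oplus> Const Delta"
      by (intro Alt_cong eqv_refl imm_CMerge_Delay that) (simp_all add: wfs imm_wf that)
    also have "\<dots> \<approx> s \<parallel>\<^sub>C k"
      by (rule Alt_Delta) (simp add: wfs imm_wf that)
    finally show ?thesis .
  qed
  with timed_Delay_Alt show ?thesis by (blast intro: that)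
qed

lemma imm_CMerge_timed_imm: "\<lbrakk>imm s; timed t\<rbrakk> \<Longrightarrow> imm (s \<parallel>\<^sub>C t)"
  by (meson imm_CMerge_timed imm_CMerge eqv_imm)

lemma timed_CMerge: "\<lbrakk>timed s; timed t\<rbrakk> \<Longrightarrow> timed (s \<parallel>\<^sub>C t)"
proof (induction arbitrary: t rule: timed.induct)
  case (timed_imm s)
  then show ?case by (blast intro: timed.timed_imm imm_CMerge_timed_imm)
next
  case (timed_Delay_Alt h u s)
  note s = timed_Delay_Alt
  note wfs = imm_wf [OF s(1)] timed_wf [OF s(2)] timed_wf [OF s(5)]
  have "s \<parallel>\<^sub>C t \<approx> (h \<oplus> Delay u) \<parallel>\<^sub>C t"
    by (intro CMerge_cong s eqv_refl wfs)
  also have "\<dots> \<approx> h \<parallel>\<^sub>C t \<oplus> Delay u \<parallel>\<^sub>C t"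
    by (rule acp [OF C7]) (simp_all add: wfs)
  finally have eq: "s \<parallel>\<^sub>C t \<approx> h \<parallel>\<^sub>C t \<oplus> Delay u \<parallel>\<^sub>C t" .
  from s(5) have "timed (Delay u \<parallel>\<^sub>C t)"
  proof cases
    case timed_imm
    then show ?thesis
      using wfs by (blast intro: timed.timed_imm imm_Const eqv_imm Delay_CMerge_imm Delta_acts)
  next
    case (timed_Delay_Alt k v)
    note wfs = wfs imm_wf [OF timed_Delay_Alt(1)] timed_wf [OF timed_Delay_Alt(2)]
    have "Delay u \<parallel>\<^sub>C t \<approx> Delay u \<parallel>\<^sub>C (k \<oplus> Delay v)"
      by (intro CMerge_cong timed_Delay_Alt eqv_refl) (simp add: wfs)
    also have "\<dots> \<approx> Delay u \<parallel>\<^sub>C k \<oplus> Delay u \<parallel>\<^sub>C Delay v"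
      by (rule acp [OF C8]) (simp_all add: wfs)
    also have "\<dots> \<approx> Const Delta \<oplus> Delay (u \<parallel>\<^sub>C v)"
      by (intro Alt_cong Delay_CMerge_imm timed_Delay_Alt acp [OF C6]) (simp_all add: wfs)
    also have "\<dots> \<approx> Delay (u \<parallel>\<^sub>C v)"
      by (rule Delta_Alt) (simp add: wfs)
    finally show ?thesis
      using s(4) timed_Delay_Alt by (blast intro: eqv_timed timed_Delay)
  qed
  then show ?case
    using eq s by (blast intro: eqv_timed timed_imm_Alt imm_CMerge_timed_imm)
qed

lemma timed_Par: "\<lbrakk>timed s; timed t\<rbrakk> \<Longrightarrow> timed (s \<parallel> t)"
  by (rule eqv_timed [OF acp [OF M1]])
    (auto intro: timed_Alt timed_LMerge timed_CMerge dest: timed_wf)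

text \<open>This is where closedness is used: variables have no normal form, while every operator
  preserves normal forms.\<close>

lemma closed_timed: "closed_trm A t \<Longrightarrow> timed t"
  unfolding closed_trm_def
  by (induction t)
    (auto intro: timed_imm imm_Const timed_Alt timed_Seq timed_Par timed_LMerge timed_CMerge
      timed_Delay timed_Encap timed_Abstr timed_Tout)


subsection \<open>Absorption of ternary communications\<close>

text \<open>One immediate component suffices: it reduces the other two to their immediate parts, and
  \<open>imm_handshaking\<close> applies. The next two lemmas move the immediate component into
  first position.\<close>

lemma imm_timed_handshaking:
  assumes "imm x" "timed y" "timed z"
  shows "(x \<parallel>\<^sub>C y) \<parallel>\<^sub>C z \<approx> Const Delta"
proof -
  obtain k where k: "imm k" "\<And>s. imm s \<Longrightarrow> s \<parallel>\<^sub>C y \<approx> s \<parallel>\<^sub>C k"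
    using imm_CMerge_timed assms by blast
  obtain l where l: "imm l" "\<And>s. imm s \<Longrightarrow> s \<parallel>\<^sub>C z \<approx> s \<parallel>\<^sub>C l"
    using imm_CMerge_timed assms by blast
  have "(x \<parallel>\<^sub>C y) \<parallel>\<^sub>C z \<approx> (x \<parallel>\<^sub>C k) \<parallel>\<^sub>C z"
    by (intro CMerge_cong k assms eqv_refl timed_wf)
  also have "\<dots> \<approx> (x \<parallel>\<^sub>C k) \<parallel>\<^sub>C l"
    by (intro l imm_CMerge assms k)
  also have "\<dots> \<approx> Const Delta"
    by (intro imm_handshaking assms k l)
  finally show ?thesis .
qed

lemma imm_timed_handshaking2:
  assumes "timed x" "imm y" "timed z"
  shows "(x \<parallel>\<^sub>C y) \<parallel>\<^sub>C z \<approx> Const Delta"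
  by (rule eqv_trans [OF CMerge_cong [OF CMerge_commute eqv_refl] imm_timed_handshaking])
    (use assms in \<open>auto intro: imm_wf timed_wf\<close>)

lemma imm_timed_handshaking3:
  assumes "timed x" "timed y" "imm z"
  shows "(x \<parallel>\<^sub>C y) \<parallel>\<^sub>C z \<approx> Const Delta"
proof -
  have "(x \<parallel>\<^sub>C y) \<parallel>\<^sub>C z \<approx> z \<parallel>\<^sub>C (x \<parallel>\<^sub>C y)"
    by (rule CMerge_commute) (use assms in \<open>auto intro: imm_wf timed_wf\<close>)
  also have "\<dots> \<approx> (z \<parallel>\<^sub>C x) \<parallel>\<^sub>C y"
    by (rule eqv_sym [OF CMerge_assoc]) (use assms in \<open>auto intro: imm_wf timed_wf\<close>)
  also have "\<dots> \<approx> Const Delta"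
    by (intro imm_timed_handshaking assms)
  finally show ?thesis .
qed

text \<open>Induction on the delays of \<open>x\<close>. If one component cannot wait, the ternary
  communication is \<open>Const Delta\<close>. Otherwise expanding all three leaves only
  \<open>Delay ((x' \<parallel>\<^sub>C y') \<parallel>\<^sub>C z')\<close>, and the left merge has
  the summand \<open>Delay ((x' \<parallel>\<^sub>C y') \<parallel>\<^sub>L z')\<close>; the
  induction hypothesis compares the bodies.\<close>

lemma CMerge3_summand:
  "\<lbrakk>timed x; timed y; timed z\<rbrakk> \<Longrightarrow> (x \<parallel>\<^sub>C y) \<parallel>\<^sub>C z \<sqsubseteq> (x \<parallel>\<^sub>C y) \<parallel>\<^sub>L z"
proof (induction arbitrary: y z rule: timed.induct)
  case (timed_imm x)
  then show ?case
    by (intro summand_eqv [OF imm_timed_handshaking Delta_summand]) (auto dest: imm_wf timed_wf)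
next
  case (timed_Delay_Alt h x' x)
  note x = timed_Delay_Alt
  have tx: "timed x" "timed (Delay x')"
    using x by (blast intro: timed.timed_Delay_Alt timed_Delay)+
  note wx = imm_wf [OF x(1)] timed_wf [OF x(2)] timed_wf [OF tx(1)]
    timed_wf [OF x(5)] timed_wf [OF x(6)]
  from x(5) show ?case
  proof cases
    case timed_imm
    then show ?thesis
      using tx x wx by (intro summand_eqv [OF imm_timed_handshaking2 Delta_summand]) auto
  next
    case (timed_Delay_Alt k y')
    note y = timed_Delay_Alt
    note wy = imm_wf [OF y(1)] timed_wf [OF y(2)]
    from x(6) show ?thesis
    proof cases
      case timed_imm
      then show ?thesis
        using tx x wx by (intro summand_eqv [OF imm_timed_handshaking3 Delta_summand]) auto
    next
      case (timed_Delay_Alt l z')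
      note z = timed_Delay_Alt
      note w = wx wy imm_wf [OF z(1)] timed_wf [OF z(2)]
      let ?w = "(x \<parallel>\<^sub>C y) \<parallel>\<^sub>L z"
      have wfw: "wf ?w" using w by simp
      \<comment> \<open>The purely delayed parts are treated first: C6 on the left operand and M5 on
        the whole exhibit the delayed summand of \<open>?w\<close>.\<close>
      have "Delay x' \<sqsubseteq> x" "Delay y' \<sqsubseteq> y"
        using w x(3) y(3) by (auto intro: eqv_summand [OF summand_Alt2 eqv_sym])
      then have "Delay x' \<parallel>\<^sub>C Delay y' \<sqsubseteq> x \<parallel>\<^sub>C y"
        using w by (intro summand_trans [OF CMerge_mono1 CMerge_mono]) auto
      then have "Delay (x' \<parallel>\<^sub>C y') \<sqsubseteq> x \<parallel>\<^sub>C y"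
        using w by (intro summand_eqv [OF acp_sym [OF C6]]) auto
      then have "Delay (x' \<parallel>\<^sub>C y') \<parallel>\<^sub>L z \<sqsubseteq> ?w"
        using w by (intro LMerge_mono)
      moreover have "Delay (x' \<parallel>\<^sub>C y') \<parallel>\<^sub>L z \<approx> Delay ((x' \<parallel>\<^sub>C y') \<parallel>\<^sub>L z')"
        using w z by (intro Delay_LMerge_Delay [of l]) auto
      ultimately have "Delay ((x' \<parallel>\<^sub>C y') \<parallel>\<^sub>L z') \<sqsubseteq> ?w"
        by (blast intro: summand_eqv eqv_sym)
      moreover have "Delay ((x' \<parallel>\<^sub>C y') \<parallel>\<^sub>C z') \<sqsubseteq> Delay ((x' \<parallel>\<^sub>C y') \<parallel>\<^sub>L z')"
        by (intro Delay_mono x(4) y(2) z(2))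
      ultimately have "Delay ((x' \<parallel>\<^sub>C y') \<parallel>\<^sub>C z') \<sqsubseteq> ?w"
        by (blast intro: summand_trans)
      moreover have "(Delay x' \<parallel>\<^sub>C Delay y') \<parallel>\<^sub>C Delay z' \<approx> Delay ((x' \<parallel>\<^sub>C y') \<parallel>\<^sub>C z')"
        using w by (intro eqv_trans [OF CMerge_cong [OF acp [OF C6] eqv_refl] acp [OF C6]]) auto
      ultimately have 1: "(Delay x' \<parallel>\<^sub>C Delay y') \<parallel>\<^sub>C Delay z' \<sqsubseteq> ?w"
        by (blast intro: summand_eqv)
      \<comment> \<open>From here the delayed factors are replaced by \<open>z\<close>,
        \<open>y\<close> and \<open>x\<close> in turn. Each replacement adds one summand with an
        immediate factor, and that summand vanishes.\<close>
      have "(Delay x' \<parallel>\<^sub>C Delay y') \<parallel>\<^sub>C z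
              \<approx> (Delay x' \<parallel>\<^sub>C Delay y') \<parallel>\<^sub>C l \<oplus> (Delay x' \<parallel>\<^sub>C Delay y') \<parallel>\<^sub>C Delay z'"
        using w by (intro eqv_trans [OF CMerge_cong [OF eqv_refl z(3)] acp [OF C8]]) auto
      moreover have "(Delay x' \<parallel>\<^sub>C Delay y') \<parallel>\<^sub>C l \<sqsubseteq> ?w"
        using x y z wfw
        by (intro summand_eqv [OF imm_timed_handshaking3 Delta_summand] timed_Delay) auto
      ultimately have 2: "(Delay x' \<parallel>\<^sub>C Delay y') \<parallel>\<^sub>C z \<sqsubseteq> ?w"
        using 1 by (blast intro: summand_eqv Alt_summand)
      have "Delay x' \<parallel>\<^sub>C y \<approx> Delay x' \<parallel>\<^sub>C k \<oplus> Delay x' \<parallel>\<^sub>C Delay y'"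
        using w by (intro eqv_trans [OF CMerge_cong [OF eqv_refl y(3)] acp [OF C8]]) auto
      then have "(Delay x' \<parallel>\<^sub>C y) \<parallel>\<^sub>C z
              \<approx> (Delay x' \<parallel>\<^sub>C k) \<parallel>\<^sub>C z \<oplus> (Delay x' \<parallel>\<^sub>C Delay y') \<parallel>\<^sub>C z"
        by (rule eqv_trans [OF CMerge_cong [OF _ eqv_refl] acp [OF C7]]) (use w in auto)
      moreover have "(Delay x' \<parallel>\<^sub>C k) \<parallel>\<^sub>C z \<sqsubseteq> ?w"
        using tx x y wfw
        by (intro summand_eqv [OF imm_timed_handshaking2 Delta_summand]) auto
      ultimately have 3: "(Delay x' \<parallel>\<^sub>C y) \<parallel>\<^sub>C z \<sqsubseteq> ?w"
        using 2 by (blast intro: summand_eqv Alt_summand)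
      have "x \<parallel>\<^sub>C y \<approx> h \<parallel>\<^sub>C y \<oplus> Delay x' \<parallel>\<^sub>C y"
        using w by (intro eqv_trans [OF CMerge_cong [OF x(3) eqv_refl] acp [OF C7]]) auto
      then have "(x \<parallel>\<^sub>C y) \<parallel>\<^sub>C z \<approx> (h \<parallel>\<^sub>C y) \<parallel>\<^sub>C z \<oplus> (Delay x' \<parallel>\<^sub>C y) \<parallel>\<^sub>C z"
        by (rule eqv_trans [OF CMerge_cong [OF _ eqv_refl] acp [OF C7]]) (use w in auto)
      moreover have "(h \<parallel>\<^sub>C y) \<parallel>\<^sub>C z \<sqsubseteq> ?w"
        using x wfw by (intro summand_eqv [OF imm_timed_handshaking Delta_summand]) auto
      ultimately show ?thesis
        using 3 by (blast intro: summand_eqv Alt_summand)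
    qed
  qed
qed


subsection \<open>The expansion\<close>

lemma wf_alt_list: "(\<And>t. t \<in> set ts \<Longrightarrow> wf t) \<Longrightarrow> wf (alt_list ts)"
  by (induction ts rule: alt_list.induct) auto

lemma wf_par_list: "(\<And>t. t \<in> set ts \<Longrightarrow> wf t) \<Longrightarrow> wf (par_list ts)"
  by (induction ts rule: par_list.induct) auto

lemma alt_list_summand: "\<lbrakk>wf u; \<And>t. t \<in> set ts \<Longrightarrow> t \<sqsubseteq> u\<rbrakk> \<Longrightarrow> alt_list ts \<sqsubseteq> u"
  by (induction ts rule: alt_list.induct) (auto intro: Delta_summand Alt_summand)

lemma summand_alt_list:
  "\<lbrakk>t \<in> set ts; \<And>s. s \<in> set ts \<Longrightarrow> wf s\<rbrakk> \<Longrightarrow> t \<sqsubseteq> alt_list ts"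
proof (induction ts rule: alt_list.induct)
  case (3 s u us)
  then have wfs: "wf s" "wf (alt_list (u # us))" by (auto intro!: wf_alt_list)
  show ?case
  proof (cases "t = s")
    case True
    then show ?thesis using wfs by (simp add: summand_Alt1)
  next
    case False
    then have "t \<sqsubseteq> alt_list (u # us)" using 3 by auto
    then show ?thesis using wfs by (auto intro: summand_trans [OF _ summand_Alt2])
  qed
qed (auto intro: summand_refl eqv_refl)

lemma alt_list_LMerge:
  "\<lbrakk>\<And>t. t \<in> set ts \<Longrightarrow> wf t; wf z\<rbrakk> \<Longrightarrow> alt_list ts \<parallel>\<^sub>L z \<approx> alt_list (map (\<lambda>t. t \<parallel>\<^sub>L z) ts)"
proof (induction ts rule: alt_list.induct)
  case 1
  then show ?case by (auto intro!: eqv_trans [OF acp [OF M2] acp [OF A7]])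
next
  case (2 t)
  then show ?case by (auto intro: eqv_refl)
next
  case (3 t u us)
  have "wf (alt_list (u # us))" using 3 by (auto intro!: wf_alt_list)
  then show ?case
    using 3 by (auto intro!: eqv_trans [OF acp [OF M6] Alt_cong] eqv_refl)
qed

text \<open>The list must be nonempty because no axiom evaluates
  \<open>z \<parallel>\<^sub>C Const Delta\<close> for arbitrary \<open>z\<close>; for the left
  merge, M2 and A7 settle the empty sum.\<close>

lemma CMerge_alt_list:
  "\<lbrakk>ts \<noteq> []; \<And>t. t \<in> set ts \<Longrightarrow> wf t; wf z\<rbrakk> \<Longrightarrow>
    z \<parallel>\<^sub>C alt_list ts \<approx> alt_list (map (\<lambda>t. z \<parallel>\<^sub>C t) ts)"
proof (induction ts rule: alt_list.induct)
  case (2 t)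
  then show ?case by (auto intro: eqv_refl)
next
  case (3 t u us)
  have "wf (alt_list (u # us))" using 3 by (auto intro!: wf_alt_list)
  then show ?case
    using 3 by (auto intro!: eqv_trans [OF acp [OF C8] Alt_cong] eqv_refl)
qed simp

section \<open>Parallel compositions of lists\<close>

lemma par_list_Cons: "ts \<noteq> [] \<Longrightarrow> par_list (t # ts) = t \<parallel> par_list ts"
  by (cases ts) auto

text \<open>The reordering that absorption calls for: a component released from a ternary
  communication returns to its place in index order.\<close>

lemma par_list_move:
  "\<lbrakk>\<And>s. s \<in> set (t # as @ bs) \<Longrightarrow> wf s\<rbrakk> \<Longrightarrow> par_list (t # as @ bs) \<approx> par_list (as @ t # bs)"
proof (induction as)
  case Nil
  then show ?case by (auto intro!: eqv_refl wf_par_list)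
next
  case (Cons a as)
  then have wfs: "wf t" "wf a" by auto
  show ?case
  proof (cases "as @ bs = []")
    case True
    then show ?thesis using wfs by (auto intro: Par_commute)
  next
    case False
    have wfp: "wf (par_list (as @ bs))" using Cons.prems by (auto intro!: wf_par_list)
    have "t \<parallel> (a \<parallel> par_list (as @ bs)) \<approx> (t \<parallel> a) \<parallel> par_list (as @ bs)"
      by (rule eqv_sym [OF Par_assoc]) (simp_all add: wfs wfp)
    also have "\<dots> \<approx> (a \<parallel> t) \<parallel> par_list (as @ bs)"
      by (intro Par_cong Par_commute eqv_refl) (simp_all add: wfs wfp)
    also have "\<dots> \<approx> a \<parallel> (t \<parallel> par_list (as @ bs))"
      by (rule Par_assoc) (simp_all add: wfs wfp)
    also have "\<dots> = a \<parallel> par_list (t # as @ bs)"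
      using False by (simp add: par_list_Cons)
    also have "\<dots> \<approx> a \<parallel> par_list (as @ t # bs)"
      using Cons by (intro Par_cong eqv_refl) auto
    finally show ?thesis using False by (simp add: par_list_Cons)
  qed
qed

text \<open>
  With this convention for the empty composition the expansion equation also holds for one and
  two components, so that the induction can start with a single one.
\<close>

definition lmerge_list :: "'a trm \<Rightarrow> 'a trm list \<Rightarrow> 'a trm" where
  "lmerge_list w ts = (if ts = [] then w else w \<parallel>\<^sub>L par_list ts)"

lemma wf_lmerge_list: "\<lbrakk>wf w; \<And>t. t \<in> set ts \<Longrightarrow> wf t\<rbrakk> \<Longrightarrow> wf (lmerge_list w ts)"
  by (simp add: lmerge_list_def wf_par_list)

lemma lmerge_list_mono:
  "\<lbrakk>v \<sqsubseteq> w; \<And>t. t \<in> set ts \<Longrightarrow> wf t\<rbrakk> \<Longrightarrow> lmerge_list v ts \<sqsubseteq> lmerge_list w ts"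
  by (simp add: lmerge_list_def wf_par_list LMerge_mono)

lemma lmerge_list_cong:
  "\<lbrakk>v \<approx> w; \<And>t. t \<in> set ts \<Longrightarrow> wf t\<rbrakk> \<Longrightarrow> lmerge_list v ts \<approx> lmerge_list w ts"
  by (auto simp add: lmerge_list_def wf_par_list intro!: LMerge_cong eqv_refl)

lemma lmerge_list_move:
  "\<lbrakk>wf w; \<And>s. s \<in> set (t # as @ bs) \<Longrightarrow> wf s\<rbrakk> \<Longrightarrow>
    lmerge_list w (t # as @ bs) \<approx> lmerge_list w (as @ t # bs)"
  by (auto simp add: lmerge_list_def intro!: LMerge_cong eqv_refl par_list_move)

text \<open>The component joining from the right is commuted to the head, since the induction adds
  the least index and its place is in front of all others.\<close>

lemma lmerge_list_LMerge:
  assumes "wf w" "wf t" "\<And>s. s \<in> set ts \<Longrightarrow> wf s"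
  shows "lmerge_list w ts \<parallel>\<^sub>L t \<approx> lmerge_list w (t # ts)"
proof (cases "ts = []")
  case True
  then show ?thesis using assms by (simp add: lmerge_list_def eqv_refl)
next
  case False
  have wfp: "wf (par_list ts)" using assms by (simp add: wf_par_list)
  have "(w \<parallel>\<^sub>L par_list ts) \<parallel>\<^sub>L t \<approx> w \<parallel>\<^sub>L (par_list ts \<parallel> t)"
    by (rule LMerge_LMerge) (simp_all add: assms wfp)
  also have "\<dots> \<approx> w \<parallel>\<^sub>L (t \<parallel> par_list ts)"
    by (intro LMerge_cong Par_commute eqv_refl) (simp_all add: assms wfp)
  finally show ?thesis using False by (simp add: lmerge_list_def par_list_Cons)
qed

lemma LMerge_lmerge_list:
  assumes "wf w" "wf t" "\<And>s. s \<in> set ts \<Longrightarrow> wf s"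
  shows "lmerge_list (w \<parallel>\<^sub>L t) ts \<approx> lmerge_list w (t # ts)"
  using assms
  by (auto simp: lmerge_list_def par_list_Cons wf_par_list intro: eqv_refl LMerge_LMerge)

lemma CMerge_lmerge_list:
  assumes "wf w" "wf z" "\<And>s. s \<in> set ts \<Longrightarrow> wf s"
  shows "z \<parallel>\<^sub>C lmerge_list w ts \<approx> lmerge_list (z \<parallel>\<^sub>C w) ts"
  using assms by (auto simp: lmerge_list_def wf_par_list intro: eqv_refl CMerge_LMerge)

text \<open>Both sums form one list, over an arbitrary index list so that an induction can remove
  its head. Pairs are selected by comparing index values, not positions; this is why the expansion
  is proved for strictly increasing lists.\<close>

definition expansion_summands :: "(nat \<Rightarrow> 'a trm) \<Rightarrow> nat list \<Rightarrow> 'a trm list" where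
  "expansion_summands x is =
     [lmerge_list (x i) (map x (filter (\<lambda>j. j \<noteq> i) is)). i \<leftarrow> is] @
     [lmerge_list (x i \<parallel>\<^sub>C x j) (map x (filter (\<lambda>k. k \<noteq> i \<and> k \<noteq> j) is)).
        i \<leftarrow> is, j \<leftarrow> filter (\<lambda>j. i < j) is]"

lemma set_expansion_summands:
  "set (expansion_summands x is) =
     {lmerge_list (x i) (map x (filter (\<lambda>j. j \<noteq> i) is)) | i. i \<in> set is} \<union>
     {lmerge_list (x i \<parallel>\<^sub>C x j) (map x (filter (\<lambda>k. k \<noteq> i \<and> k \<noteq> j) is)) | i j.
        i \<in> set is \<and> j \<in> set is \<and> i < j}"
  by (auto simp: expansion_summands_def)

lemma wf_expansion_summands:
  "\<lbrakk>\<And>i. i \<in> set is \<Longrightarrow> wf (x i); t \<in> set (expansion_summands x is)\<rbrakk> \<Longrightarrow> wf t"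
  by (auto simp: set_expansion_summands intro!: wf_lmerge_list)

text \<open>With \<open>m\<close> the least index and \<open>Q\<close> the composition of the
  others, M1 splits \<open>x m \<parallel> Q\<close> into three parts.
  \<open>x m \<parallel>\<^sub>L Q\<close> is the summand in which \<open>m\<close> acts alone,
  \<open>Q \<parallel>\<^sub>L x m\<close> yields the summands in which \<open>m\<close> only waits
  in the remainder, and \<open>x m \<parallel>\<^sub>C Q\<close> yields the pairs containing
  \<open>m\<close> together with ternary communications, which are absorbed.\<close>

lemma par_list_expansion:
  "\<lbrakk>is \<noteq> []; sorted_wrt (<) is; \<And>i. i \<in> set is \<Longrightarrow> timed (x i)\<rbrakk> \<Longrightarrow>
    par_list (map x is) \<approx> alt_list (expansion_summands x is)"
proof (induction "is")
  case Nil
  then show ?case by simp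
next
  case (Cons m ks)
  have less: "m < k" if "k \<in> set ks" for k using that Cons.prems(2) by simp
  have sorted: "sorted_wrt (<) ks" using Cons.prems(2) by simp
  then have dist: "distinct ks" by (simp add: strict_sorted_iff)
  have timed: "timed (x i)" if "i = m \<or> i \<in> set ks" for i using that Cons.prems(3) by auto
  have wfx: "wf (x i)" if "i = m \<or> i \<in> set ks" for i using timed [OF that] by (rule timed_wf)
  note wfm = wfx [of m, simplified]
  show ?case
  proof (cases "ks = []")
    case True
    then show ?thesis by (simp add: expansion_summands_def lmerge_list_def eqv_refl wfm)
  next
    case False
    define Q U where "Q = par_list (map x ks)" and "U = alt_list (expansion_summands x (m # ks))"
    have wfQ: "wf Q" unfolding Q_def using wfx by (auto intro!: wf_par_list)
    have wfT: "wf t" if "t \<in> set (expansion_summands x ks)" for t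
      using wf_expansion_summands [OF _ that] wfx by blast
    have wfT': "wf t" if "t \<in> set (expansion_summands x (m # ks))" for t
      using wf_expansion_summands [OF _ that] wfx by auto
    have wfU: "wf U" unfolding U_def using wfT' by (rule wf_alt_list)
    have IH: "Q \<approx> alt_list (expansion_summands x ks)"
      unfolding Q_def using Cons.IH False sorted timed by blast
    have ne: "expansion_summands x ks \<noteq> []"
      using False by (simp add: expansion_summands_def)
    have drop1: "filter (\<lambda>j. j \<noteq> m) ks = ks"
      using less by (auto intro!: filter_True)
    have drop2: "filter (\<lambda>k. k \<noteq> m \<and> k \<noteq> i) ks = filter (\<lambda>k. k \<noteq> i) ks" for i
      using less by (auto intro!: filter_cong)
    have U: "t \<sqsubseteq> U" if "t \<in> set (expansion_summands x (m # ks))" for t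
      unfolding U_def using that wfT' by (rule summand_alt_list)
    \<comment> \<open>\<open>U1\<close> to \<open>U4\<close> sort the summands of \<open>U\<close>
      by the role of \<open>m\<close>: acting alone, waiting beside a single \<open>i\<close>,
      communicating with \<open>i\<close>, waiting beside a pair.\<close>
    have U1: "x m \<parallel>\<^sub>L Q \<sqsubseteq> U"
      by (rule U) (auto simp: set_expansion_summands Q_def lmerge_list_def drop1 False intro!: exI [of _ m])
    have U2: "lmerge_list (x i) (x m # map x (filter (\<lambda>j. j \<noteq> i) ks)) \<sqsubseteq> U" if "i \<in> set ks" for i
      using less [OF that] that by (intro U) (auto simp: set_expansion_summands intro!: exI [of _ i])
    have U3: "lmerge_list (x m \<parallel>\<^sub>C x i) (map x (filter (\<lambda>j. j \<noteq> i) ks)) \<sqsubseteq> U" if "i \<in> set ks" for i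
      using less [OF that] that
      by (intro U [unfolded set_expansion_summands] UnI2 CollectI exI [of _ m] exI [of _ i])
        (auto simp: drop2)
    have U4: "lmerge_list (x i \<parallel>\<^sub>C x j) (x m # map x (filter (\<lambda>k. k \<noteq> i \<and> k \<noteq> j) ks)) \<sqsubseteq> U"
      if "i \<in> set ks" "j \<in> set ks" "i < j" for i j
      using less [OF that(1)] less [OF that(2)] that
      by (intro U [unfolded set_expansion_summands] UnI2 CollectI exI [of _ i] exI [of _ j]) auto
    have wfm1: "wf t" if "t \<in> set (map x (filter P ks))" for t P
      using that wfx by auto
    have Q1: "t \<sqsubseteq> Q" if "t \<in> set (expansion_summands x ks)" for t
      using summand_alt_list [OF that wfT] IH by (blast intro: eqv_summand eqv_sym)

    have left: "Q \<parallel>\<^sub>L x m \<sqsubseteq> U"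
    proof (rule summand_eqv)
      show "Q \<parallel>\<^sub>L x m \<approx> alt_list (map (\<lambda>t. t \<parallel>\<^sub>L x m) (expansion_summands x ks))"
        by (rule eqv_trans [OF LMerge_cong [OF IH eqv_refl] alt_list_LMerge])
          (simp_all add: wfm wfT)
      show "alt_list (map (\<lambda>t. t \<parallel>\<^sub>L x m) (expansion_summands x ks)) \<sqsubseteq> U"
      proof (rule alt_list_summand [OF wfU])
        fix t assume "t \<in> set (map (\<lambda>t. t \<parallel>\<^sub>L x m) (expansion_summands x ks))"
        then consider i where "i \<in> set ks"
            "t = lmerge_list (x i) (map x (filter (\<lambda>j. j \<noteq> i) ks)) \<parallel>\<^sub>L x m"
          | i j where "i \<in> set ks" "j \<in> set ks" "i < j"
            "t = lmerge_list (x i \<parallel>\<^sub>C x j) (map x (filter (\<lambda>k. k \<noteq> i \<and> k \<noteq> j) ks)) \<parallel>\<^sub>L x m"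
          by (auto simp: set_expansion_summands)
        then show "t \<sqsubseteq> U"
        proof cases
          case 1
          then show ?thesis
            using wfx wfm1 by (auto intro!: summand_eqv [OF lmerge_list_LMerge U2])
        next
          case 2
          then show ?thesis
            using wfx wfm1 by (auto intro!: summand_eqv [OF lmerge_list_LMerge U4])
        qed
      qed
    qed
    have comm: "x m \<parallel>\<^sub>C Q \<sqsubseteq> U"
    proof (rule summand_eqv)
      show "x m \<parallel>\<^sub>C Q \<approx> alt_list (map (\<lambda>t. x m \<parallel>\<^sub>C t) (expansion_summands x ks))"
        by (rule eqv_trans [OF CMerge_cong [OF eqv_refl IH] CMerge_alt_list])
          (simp_all add: wfm wfT ne)
      show "alt_list (map (\<lambda>t. x m \<parallel>\<^sub>C t) (expansion_summands x ks)) \<sqsubseteq> U"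
      proof (rule alt_list_summand [OF wfU])
        fix t assume "t \<in> set (map (\<lambda>t. x m \<parallel>\<^sub>C t) (expansion_summands x ks))"
        then consider i where "i \<in> set ks"
            "t = x m \<parallel>\<^sub>C lmerge_list (x i) (map x (filter (\<lambda>j. j \<noteq> i) ks))"
          | i j where "i \<in> set ks" "j \<in> set ks" "i < j"
            "t = x m \<parallel>\<^sub>C lmerge_list (x i \<parallel>\<^sub>C x j) (map x (filter (\<lambda>k. k \<noteq> i \<and> k \<noteq> j) ks))"
          by (auto simp: set_expansion_summands)
        then show "t \<sqsubseteq> U"
        proof cases
          case 1
          then show ?thesis
            using wfx wfm1 by (auto intro!: summand_eqv [OF CMerge_lmerge_list U3])
        next
          case (2 i j)
          let ?r = "filter (\<lambda>k. k \<noteq> i \<and> k \<noteq> j) ks"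
          have wfs: "wf (x i)" "wf (x j)" using 2 wfx by auto
          \<comment> \<open>Absorption will release \<open>x j\<close> into the remainder;
            \<open>as\<close> and \<open>bs\<close> record its place among the indices other than
            \<open>i\<close>.\<close>
          have "j \<in> set (filter (\<lambda>k. k \<noteq> i) ks)" using 2 by auto
          then obtain as bs where split: "filter (\<lambda>k. k \<noteq> i) ks = as @ j # bs"
            by (blast dest: split_list)
          have "distinct (as @ j # bs)" using dist by (simp flip: split)
          then have "filter (\<lambda>k. k \<noteq> j) as = as" "filter (\<lambda>k. k \<noteq> j) bs = bs"
            by (auto intro!: filter_True)
          then have "filter (\<lambda>k. k \<noteq> j) (as @ j # bs) = as @ bs"
            by simp
          then have r: "?r = as @ bs"
            by (simp flip: split add: conj_commute)
          have "set (as @ j # bs) \<subseteq> set ks" by (simp flip: split)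
          then have wfab: "wf s" if "s \<in> set (map x (as @ j # bs))" for s using wfx that by auto
          have "t \<approx> lmerge_list (x m \<parallel>\<^sub>C (x i \<parallel>\<^sub>C x j)) (map x ?r)"
            unfolding 2(4) by (rule CMerge_lmerge_list) (use wfs wfm wfx in auto)
          also have "\<dots> \<approx> lmerge_list ((x m \<parallel>\<^sub>C x i) \<parallel>\<^sub>C x j) (map x ?r)"
            by (intro lmerge_list_cong eqv_sym [OF CMerge_assoc]) (use wfs wfm wfx in auto)
          finally have t: "t \<approx> lmerge_list ((x m \<parallel>\<^sub>C x i) \<parallel>\<^sub>C x j) (map x ?r)" .
          \<comment> \<open>The ternary communication is absorbed: \<open>x j\<close> turns from a
            communication partner into a left merge partner and can join the remainder, which leads
            to the summand of the pair \<open>m\<close>, \<open>i\<close> in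
            \<open>U3\<close>.\<close>
          have "lmerge_list ((x m \<parallel>\<^sub>C x i) \<parallel>\<^sub>C x j) (map x ?r)
                  \<sqsubseteq> lmerge_list ((x m \<parallel>\<^sub>C x i) \<parallel>\<^sub>L x j) (map x ?r)"
            by (intro lmerge_list_mono CMerge3_summand timed) (use 2 wfx in auto)
          with t have "t \<sqsubseteq> lmerge_list ((x m \<parallel>\<^sub>C x i) \<parallel>\<^sub>L x j) (map x ?r)"
            by (rule summand_eqv)
          moreover have "lmerge_list ((x m \<parallel>\<^sub>C x i) \<parallel>\<^sub>L x j) (map x ?r)
                  \<approx> lmerge_list (x m \<parallel>\<^sub>C x i) (x j # map x ?r)"
            by (rule LMerge_lmerge_list) (use wfs wfm wfx in auto)
          moreover have "lmerge_list (x m \<parallel>\<^sub>C x i) (x j # map x ?r)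
                  \<approx> lmerge_list (x m \<parallel>\<^sub>C x i) (map x (filter (\<lambda>k. k \<noteq> i) ks))"
            unfolding r split map_append list.map
            by (rule lmerge_list_move) (use wfs wfm wfab in auto)
          ultimately show ?thesis
            using U3 [OF 2(1)] by (blast intro: eqv_summand summand_trans)
        qed
      qed
    qed
    define V where "V = (x m \<parallel>\<^sub>L Q \<oplus> Q \<parallel>\<^sub>L x m) \<oplus> x m \<parallel>\<^sub>C Q"
    have V: "x m \<parallel> Q \<approx> V"
      unfolding V_def by (rule acp [OF M1]) (simp_all add: wfm wfQ)
    have wfV: "wf V" using V by (rule eqv_wf2)
    have V1: "x m \<parallel>\<^sub>L Q \<sqsubseteq> V"
      unfolding V_def using wfm wfQ by (intro summand_trans [OF summand_Alt1 summand_Alt1]) auto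
    have V2: "Q \<parallel>\<^sub>L x m \<sqsubseteq> V"
      unfolding V_def using wfm wfQ by (intro summand_trans [OF summand_Alt2 summand_Alt1]) auto
    have V3: "x m \<parallel>\<^sub>C Q \<sqsubseteq> V"
      unfolding V_def using wfm wfQ by (intro summand_Alt2) auto
    \<comment> \<open>For the inclusion of \<open>U\<close> in \<open>V\<close>, each summand of
      \<open>Q\<close> is carried by monotonicity into the second or the third part of M1.\<close>
    have V2': "lmerge_list w (x m # map x r) \<sqsubseteq> V"
      if "lmerge_list w (map x r) \<in> set (expansion_summands x ks)" "wf w" "set r \<subseteq> set ks" for w r
    proof -
      have "lmerge_list w (x m # map x r) \<approx> lmerge_list w (map x r) \<parallel>\<^sub>L x m"
        by (rule eqv_sym [OF lmerge_list_LMerge]) (use that wfx in auto)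
      moreover have "lmerge_list w (map x r) \<parallel>\<^sub>L x m \<sqsubseteq> Q \<parallel>\<^sub>L x m"
        by (rule LMerge_mono [OF Q1 [OF that(1)] wfm])
      ultimately show ?thesis using V2 by (blast intro: summand_eqv summand_trans)
    qed
    have V3': "lmerge_list (x m \<parallel>\<^sub>C w) (map x r) \<sqsubseteq> V"
      if "lmerge_list w (map x r) \<in> set (expansion_summands x ks)" "wf w" "set r \<subseteq> set ks" for w r
    proof -
      have "lmerge_list (x m \<parallel>\<^sub>C w) (map x r) \<approx> x m \<parallel>\<^sub>C lmerge_list w (map x r)"
        by (rule eqv_sym [OF CMerge_lmerge_list]) (use that wfx in auto)
      moreover have "x m \<parallel>\<^sub>C lmerge_list w (map x r) \<sqsubseteq> x m \<parallel>\<^sub>C Q"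
        by (rule CMerge_mono [OF Q1 [OF that(1)] wfm])
      ultimately show ?thesis using V3 by (blast intro: summand_eqv summand_trans)
    qed
    have "U \<sqsubseteq> V"
      unfolding U_def
    proof (rule alt_list_summand [OF wfV])
      fix t assume "t \<in> set (expansion_summands x (m # ks))"
      then consider i where "i \<in> set (m # ks)"
          "t = lmerge_list (x i) (map x (filter (\<lambda>j. j \<noteq> i) (m # ks)))"
        | i j where "i \<in> set (m # ks)" "j \<in> set (m # ks)" "i < j"
          "t = lmerge_list (x i \<parallel>\<^sub>C x j) (map x (filter (\<lambda>k. k \<noteq> i \<and> k \<noteq> j) (m # ks)))"
        unfolding set_expansion_summands by blast
      then show "t \<sqsubseteq> V"
      proof cases
        case (1 i)
        show ?thesis
        proof (cases "i = m")
          case True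
          then show ?thesis using 1 V1 False by (simp add: drop1 lmerge_list_def Q_def)
        next
          case neq: False
          then have "t = lmerge_list (x i) (x m # map x (filter (\<lambda>j. j \<noteq> i) ks))" "i \<in> set ks"
            using 1 by auto
          then show ?thesis
            using wfx by (auto simp: set_expansion_summands intro!: V2')
        qed
      next
        case (2 i j)
        \<comment> \<open>\<open>j\<close> exceeds another index, so it cannot be the least index
          \<open>m\<close>.\<close>
        then have j: "j \<in> set ks" using less by fastforce
        show ?thesis
        proof (cases "i = m")
          case True
          then have "t = lmerge_list (x m \<parallel>\<^sub>C x j) (map x (filter (\<lambda>k. k \<noteq> j) ks))"
            using 2 by (simp add: drop2)
          then show ?thesis
            using wfx j by (auto simp: set_expansion_summands intro!: V3')
        next
          case neq: False
          then have "t = lmerge_list (x i \<parallel>\<^sub>C x j) (x m # map x (filter (\<lambda>k. k \<noteq> i \<and> k \<noteq> j) ks))"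
              "i \<in> set ks"
            using 2 less [OF j] by auto
          then show ?thesis
            using wfx j 2(3) by (auto simp: set_expansion_summands intro!: V2')
        qed
      qed
    qed
    moreover have "V \<sqsubseteq> U"
      unfolding V_def by (intro Alt_summand U1 left comm)
    ultimately have "x m \<parallel> Q \<approx> U"
      by (blast intro: eqv_trans V summand_antisym)
    then show ?thesis
      using False by (simp add: U_def Q_def par_list_Cons)
  qed
qed

section \<open>The expansion in its indexed form\<close>

lemma alt_list_append:
  assumes "\<And>t. t \<in> set (ts @ us) \<Longrightarrow> wf t"
  shows "alt_list (ts @ us) \<approx> alt_list ts \<oplus> alt_list us"
\<comment> \<open>In the order, empty lists need no case distinction: their sum
  \<open>Const Delta\<close> is the least element.\<close>
proof (rule summand_antisym)
  have wfs: "wf (alt_list ts)" "wf (alt_list us)" "wf (alt_list (ts @ us))"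
    using assms by (auto intro!: wf_alt_list)
  show "alt_list (ts @ us) \<sqsubseteq> alt_list ts \<oplus> alt_list us"
  proof (rule alt_list_summand)
    fix t assume "t \<in> set (ts @ us)"
    then consider "t \<in> set ts" | "t \<in> set us" by auto
    then show "t \<sqsubseteq> alt_list ts \<oplus> alt_list us"
    proof cases
      case 1
      then show ?thesis
        using assms wfs by (intro summand_trans [OF summand_alt_list summand_Alt1]) auto
    next
      case 2
      then show ?thesis
        using assms wfs by (intro summand_trans [OF summand_alt_list summand_Alt2]) auto
    qed
  qed (simp add: wfs)
  show "alt_list ts \<oplus> alt_list us \<sqsubseteq> alt_list (ts @ us)"
    using assms wfs by (intro Alt_summand alt_list_summand summand_alt_list) auto
qed

lemma expansion_derivable:
  assumes "n > 2" "\<And>i. \<lbrakk>1 \<le> i; i \<le> n\<rbrakk> \<Longrightarrow> timed (x i)"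
  shows "expansion_lhs n x \<approx> expansion_rhs n x"
proof -
  let ?is = "[1..<Suc n]"
  define ts where "ts = [x i \<parallel>\<^sub>L par_list [x j. j \<leftarrow> ?is, j \<noteq> i]. i \<leftarrow> ?is]"
  define us where "us = [(x i \<parallel>\<^sub>C x j) \<parallel>\<^sub>L par_list [x k. k \<leftarrow> ?is, k \<noteq> i, k \<noteq> j].
                 i \<leftarrow> ?is, j \<leftarrow> [Suc i..<Suc n]]"
  have comp1: "[x j. j \<leftarrow> js, j \<noteq> i] = map x (filter (\<lambda>j. j \<noteq> i) js)" for i js
    by (induction js) auto
  have comp2: "[x k. k \<leftarrow> js, k \<noteq> i, k \<noteq> j] = map x (filter (\<lambda>k. k \<noteq> i \<and> k \<noteq> j) js)" for i j js
    by (induction js) auto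
  have ne: "filter (\<lambda>k. k \<noteq> i \<and> k \<noteq> j) ?is \<noteq> []" for i j
  proof -
    \<comment> \<open>This is where \<open>n > 2\<close> enters: one of three indices differs from
      both \<open>i\<close> and \<open>j\<close>, so every remaining composition is nonempty and
      neither the default of \<open>par_list\<close> nor that of \<open>lmerge_list\<close>
      occurs.\<close>
    have "\<exists>k \<in> {1, 2, 3}. k \<noteq> i \<and> k \<noteq> j" by auto
    then show ?thesis using assms(1) by (auto simp: filter_empty_conv)
  qed
  have ne1: "filter (\<lambda>k. k \<noteq> i) ?is \<noteq> []" for i
    using ne [of i i] by simp
  \<comment> \<open>The stated double sum lets \<open>j\<close> start at \<open>Suc i\<close>,
    whereas \<open>expansion_summands\<close> filters by \<open>i < j\<close>; on an interval of
    indices the two lists agree.\<close>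
  have later: "filter (\<lambda>j. i < j) ?is = [Suc i..<Suc n]" if "i \<in> set ?is" for i
  proof -
    have "?is = [1..<Suc i] @ [Suc i..<Suc n]"
      using that upt_add_eq_append [of 1 "Suc i" "n - i"] by (simp del: upt_Suc)
    then show ?thesis by (auto simp: filter_empty_conv simp del: upt_Suc intro!: filter_True)
  qed
  have eq: "expansion_summands x ?is = ts @ us"
    unfolding expansion_summands_def ts_def us_def comp1 comp2 lmerge_list_def
    using ne ne1 later
    by (auto simp del: upt_Suc intro!: arg_cong [where f = concat] map_cong)
  have wfx: "wf (x i)" if "i \<in> set ?is" for i
    using that assms(2) by (auto intro: timed_wf simp del: upt_Suc)
  have "par_list (map x ?is) \<approx> alt_list (expansion_summands x ?is)"
    by (rule par_list_expansion) (use assms in \<open>auto simp del: upt_Suc\<close>)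
  also have "\<dots> \<approx> alt_list ts \<oplus> alt_list us"
    unfolding eq
    by (rule alt_list_append) (simp only: wf_expansion_summands [OF wfx] flip: eq)
  finally show ?thesis
    by (simp add: expansion_lhs_def expansion_rhs_def ts_def us_def)
qed

end

theorem theorem3:
  fixes A :: "'a set" and \<gamma> :: "'a act \<Rightarrow> 'a act \<Rightarrow> 'a act"
    and n :: nat and x :: "nat \<Rightarrow> 'a trm"
  assumes "finite A"
    and "\<And>a b. \<lbrakk>a \<in> acts A; b \<in> acts A\<rbrakk> \<Longrightarrow> \<gamma> a b \<in> acts A"
    and "\<And>a b. \<lbrakk>a \<in> acts A; b \<in> acts A\<rbrakk> \<Longrightarrow> \<gamma> a b = \<gamma> b a"
    and "\<And>a b c. \<lbrakk>a \<in> acts A; b \<in> acts A; c \<in> acts A\<rbrakk> \<Longrightarrow> \<gamma> (\<gamma> a b) c = \<gamma> a (\<gamma> b c)"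
    and "\<And>a. a \<in> acts A \<Longrightarrow> \<gamma> Tau a = Delta"
    and "\<And>a. a \<in> acts A \<Longrightarrow> \<gamma> Delta a = Delta"
    and "n > 2"
    and "\<And>i. \<lbrakk>1 \<le> i; i \<le> n\<rbrakk> \<Longrightarrow> closed_trm A (x i)"
  shows "derivable A \<gamma> (expansion_lhs n x) (expansion_rhs n x)"
proof -
  interpret acp_signature A \<gamma>
    by unfold_locales (use assms in auto)
  show ?thesis
    by (rule expansion_derivable) (use assms in \<open>auto intro: closed_timed\<close>)
qed

end
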